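(* Let $G$ be a finitely generated group and $H$ a normal subgroup of $G$ with canonical projection $p:G\to G/H$. Suppose there is a finite collection $\mathcal{A}$ of finitely generated subgroups of $G$ satisfying the following conditions: (1) The union of all subgroups in $\mathcal{A}$ generates $G$, and the subgroup $A\cap H$ is finitely generated for each $A\in\mathcal{A}$. (2) For each pair $A,A'\in\mathcal{A}$ there is a sequence $A=A_1,A_2,\dots,A_n=A'$ of subgroups in $\mathcal{A}$ such that $p(A_i\cap A_{i+1})$ is a finite index subgroup of $G/H$ for each $i\in\{1,2,\dots,n-1\}$. Then the subgroup $H$ is finitely generated and the distortion $Dist_G^H$ is dominated by the function $f(n)=n\max\{Dist_A^{A\cap H}(n) : A\in\mathcal{A}\}$.
   Context: For functions $f,g$ from $[0,\infty)$ to $[0,\infty]$ (only values at large arguments matter, so functions on $(0,\infty)$ are allowed), $f$ is dominated by $g$, written $f\preceq g$, if there are positive constants $A,B,C,D$ such that $f(x)\le A\,g(Bx)+Cx$ for all $x>D$. Let $G$ be a group with finite generating set $S$ and $H$ a subgroup with finite generating set $T$; $|\cdot|_S$ and $|\cdot|_T$ are the word lengths. The subgroup distortion is $Dist_G^H(r)=\max\{|h|_T : h\in H,\ |h|_S\le r\}$ for $r>0$; up to mutual domination it does not depend on $S$ and $T$. *)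

theory Defs
  imports "HOL-Algebra.Generated_Groups" "HOL-Library.Extended_Nonnegative_Real"
begin

definition finite_generating_set :: "('a, 'b) monoid_scheme \<Rightarrow> 'a set \<Rightarrow> bool" where
  "finite_generating_set G S \<longleftrightarrow> finite S \<and> S \<subseteq> carrier G \<and> generate G S = carrier G"

definition finitely_generated :: "('a, 'b) monoid_scheme \<Rightarrow> bool" where
  "finitely_generated G \<longleftrightarrow> (\<exists>S. finite_generating_set G S)"

definition finite_index_subgroup :: "'a set \<Rightarrow> ('a, 'b) monoid_scheme \<Rightarrow> bool" where
  "finite_index_subgroup K G \<longleftrightarrow> subgroup K G \<and> finite (rcosets\<^bsub>G\<^esub> K)"

(* The minimum is over a nonempty set of lengths whenever S generates G and g is in carrier G;
   nothing is intended otherwise. *)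
definition word_length :: "('a, 'b) monoid_scheme \<Rightarrow> 'a set \<Rightarrow> 'a \<Rightarrow> nat" where
  "word_length G S g =
     (LEAST n. \<exists>ws. length ws = n \<and> set ws \<subseteq> S \<union> m_inv G ` S
                   \<and> foldr (mult G) ws (one G) = g)"

(* For r >= 0 and S, T finite generating sets of G and of H, the set under Max is finite and
   contains 0. *)
definition distortion ::
    "('a, 'b) monoid_scheme \<Rightarrow> 'a set \<Rightarrow> 'a set \<Rightarrow> 'a set \<Rightarrow> real \<Rightarrow> ennreal" where
  "distortion G S H T r =
     of_nat (Max {word_length (G\<lparr>carrier := H\<rparr>) T h | h. h \<in> H \<and> real (word_length G S h) \<le> r})"

(* Functions on the nonnegative reals are given as functions on all reals; the bound x > D > 0
   makes their values at negative arguments irrelevant. *)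
definition dominated :: "(real \<Rightarrow> ennreal) \<Rightarrow> (real \<Rightarrow> ennreal) \<Rightarrow> bool" (infix "\<preceq>" 50) where
  "f \<preceq> g \<longleftrightarrow>
     (\<exists>A B C D :: real. A > 0 \<and> B > 0 \<and> C > 0 \<and> D > 0 \<and>
        (\<forall>x > D. f x \<le> ennreal A * g (B * x) + ennreal (C * x)))"

end

theory Submission
  imports Defs
begin

text \<open>Choose a normal subgroup \<^term>\<open>P\<close> of finite index that contains \<^term>\<open>H\<close> and lies in
  \<^term>\<open>H <#>\<^bsub>G\<^esub> (A \<inter> A')\<close> for all neighbours \<^term>\<open>A\<close>, \<^term>\<open>A'\<close> in the chains. A Schreier
  rewriting argument splits \<^term>\<open>b \<in> A \<inter> P\<close> as \<^term>\<open>h \<otimes>\<^bsub>G\<^esub> b'\<close> with \<^term>\<open>b' \<in> A' \<inter> P\<close> of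
  comparable length and \<^term>\<open>h \<in> A \<inter> H\<close>, whose length is controlled by the distortion of
  \<^term>\<open>A \<inter> H\<close> in \<^term>\<open>A\<close>. Moving along chains, elements \<^term>\<open>b\<close> of a fixed
  \<^term>\<open>A \<inter> P\<close> can be pushed past any element of \<^term>\<open>G\<close> at such a cost, so conjugates of a
  fixed \<^term>\<open>h \<in> H\<close> by such \<^term>\<open>b\<close> are short. The same rewriting, applied to \<^term>\<open>G\<close> itself,
  writes an element of \<^term>\<open>H\<close> of length \<open>n\<close> as a product of about \<open>n\<close> of these conjugates and one
  element of \<^term>\<open>A \<inter> H\<close> of linear length.\<close>

section \<open>Words of bounded length\<close>

context group begin

lemma inv_mult_cancel [simp]:
  assumes "x \<in> carrier G" "y \<in> carrier G"
  shows "inv x \<otimes> (x \<otimes> y) = y" "x \<otimes> (inv x \<otimes> y) = y"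
  using assms by (simp_all flip: m_assoc)

text \<open>The index bounds the length instead of measuring it, so the relation is monotone in
  \<open>n\<close> and in \<open>S\<close> and needs no minimum over a possibly empty set. Letters
  are appended on the right, so that induction runs through prefixes, as Schreier rewriting
  does.\<close>

inductive word_le :: "'a set \<Rightarrow> nat \<Rightarrow> 'a \<Rightarrow> bool" for S where
  one: "word_le S n \<one>"
| mult: "word_le S n g \<Longrightarrow> s \<in> S \<Longrightarrow> word_le S (Suc n) (g \<otimes> s)"
| mult_inv: "word_le S n g \<Longrightarrow> s \<in> S \<Longrightarrow> word_le S (Suc n) (g \<otimes> inv s)"

lemma word_le_closed: "word_le S n g \<Longrightarrow> S \<subseteq> carrier G \<Longrightarrow> g \<in> carrier G"
  by (induction rule: word_le.induct) auto

lemma word_le_subgroup: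
  assumes "word_le S n g" "S \<subseteq> K" "subgroup K G"
  shows "g \<in> K"
  using assms
  by (induction rule: word_le.induct)
     (auto intro: subgroup.one_closed subgroup.m_closed subgroup.m_inv_closed)

lemma word_le_mono:
  assumes "word_le S n g" "n \<le> m" "S \<subseteq> S'"
  shows "word_le S' m g"
  using assms
proof (induction arbitrary: m rule: word_le.induct)
  case (mult n g s)
  then obtain m' where "m = Suc m'" "n \<le> m'" by (cases m) auto
  then show ?case using mult by (auto intro: word_le.mult)
next
  case (mult_inv n g s)
  then obtain m' where "m = Suc m'" "n \<le> m'" by (cases m) auto
  then show ?case using mult_inv by (auto intro: word_le.mult_inv)
qed (rule word_le.one)

lemma word_le_gen: "s \<in> S \<Longrightarrow> S \<subseteq> carrier G \<Longrightarrow> word_le S (Suc 0) s"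
  using word_le.mult[OF word_le.one, of s S 0] by (simp add: subset_iff)

lemma word_le_mult:
  assumes "word_le S m h" "word_le S n g" "S \<subseteq> carrier G"
  shows "word_le S (n + m) (g \<otimes> h)"
  using assms
proof (induction rule: word_le.induct)
  case (one m)
  then show ?case by (simp add: word_le_closed word_le_mono[of S n g "n + m" S])
next
  case (mult m h s)
  then have "g \<otimes> (h \<otimes> s) = g \<otimes> h \<otimes> s" by (metis m_assoc subsetD word_le_closed)
  then show ?case using mult by (simp add: word_le.mult)
next
  case (mult_inv m h s)
  then have "g \<otimes> (h \<otimes> inv s) = g \<otimes> h \<otimes> inv s"
    by (metis m_assoc subsetD word_le_closed inv_closed)
  then show ?case using mult_inv by (simp add: word_le.mult_inv)
qed

lemma word_le_inv:
  assumes "word_le S n g" "S \<subseteq> carrier G"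
  shows "word_le S n (inv g)"
  using assms
proof (induction rule: word_le.induct)
  case (one n) then show ?case by (simp add: word_le.one)
next
  case (mult n g s)
  have s: "s \<in> carrier G" "g \<in> carrier G" using mult word_le_closed by auto
  have "word_le S (Suc 0) (\<one> \<otimes> inv s)" by (intro word_le.intros mult)
  from word_le_mult[OF mult.IH this] mult s show ?case by (simp add: inv_mult_group)
next
  case (mult_inv n g s)
  have s: "s \<in> carrier G" "g \<in> carrier G" using mult_inv word_le_closed by auto
  from word_le_mult[OF mult_inv.IH word_le_gen[of s S]] mult_inv s show ?case
    by (simp add: inv_mult_group)
qed

text \<open>Words are substituted for letters, so a change of generating set costs only a constant
  factor.\<close>

lemma word_le_trans:
  assumes "word_le V n g" "\<And>v. v \<in> V \<Longrightarrow> word_le S m v" "S \<subseteq> carrier G"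
  shows "word_le S (m * n) g"
  using assms
proof (induction rule: word_le.induct)
  case (one n) then show ?case by (simp add: word_le.one)
next
  case (mult n g s)
  then show ?case using word_le_mult[of S m s "m * n" g] by (simp add: add.commute)
next
  case (mult_inv n g s)
  then show ?case using word_le_mult[of S m "inv s" "m * n" g]
    by (simp add: add.commute word_le_inv)
qed

text \<open>Conjugation is an automorphism and acts letter by letter: the length is kept if the
  alphabet is conjugated as well.\<close>

lemma word_le_conj:
  assumes "word_le U n k" "g \<in> carrier G" "U \<subseteq> carrier G"
  shows "word_le ((\<lambda>u. g \<otimes> u \<otimes> inv g) ` U) n (g \<otimes> k \<otimes> inv g)"
  using assms
proof (induction rule: word_le.induct)
  case (one n) then show ?case by (simp add: word_le.one)
next
  case (mult n k u)
  have c: "u \<in> carrier G" "k \<in> carrier G" using mult word_le_closed by auto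
  have "g \<otimes> (k \<otimes> u) \<otimes> inv g = (g \<otimes> k \<otimes> inv g) \<otimes> (g \<otimes> u \<otimes> inv g)"
    using c mult.prems(1) by (simp add: m_assoc)
  then show ?case using mult by (auto intro!: word_le.mult)
next
  case (mult_inv n k u)
  have c: "u \<in> carrier G" "k \<in> carrier G" using mult_inv word_le_closed by auto
  have "g \<otimes> (k \<otimes> inv u) \<otimes> inv g = (g \<otimes> k \<otimes> inv g) \<otimes> inv (g \<otimes> u \<otimes> inv g)"
    using c mult_inv.prems(1) by (simp add: m_assoc inv_mult_group)
  then show ?case using mult_inv by (auto intro!: word_le.mult_inv)
qed

section \<open>Generation, finite balls and word length\<close>

lemma generate_imp_word_le:
  assumes "g \<in> generate G S" "S \<subseteq> carrier G"
  shows "\<exists>n. word_le S n g"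
  using assms
proof (induction rule: generate.induct)
  case one then show ?case using word_le.one by blast
next
  case (incl h) then show ?case using word_le_gen by blast
next
  case (inv h) then show ?case using word_le_gen word_le_inv by blast
next
  case (eng h1 h2) then show ?case using word_le_mult by blast
qed

lemma word_le_imp_generate: "word_le S n g \<Longrightarrow> S \<subseteq> carrier G \<Longrightarrow> g \<in> generate G S"
  by (rule word_le_subgroup) (auto intro: generate.incl generate_is_subgroup)

lemma word_le_uniform:
  assumes "finite V" "V \<subseteq> generate G S" "S \<subseteq> carrier G"
  obtains m where "\<And>v. v \<in> V \<Longrightarrow> word_le S m v"
proof -
  have "\<exists>f. \<forall>v\<in>V. word_le S (f v) v"
    using assms generate_imp_word_le by (intro bchoice) blast
  then obtain f where f: "\<forall>v\<in>V. word_le S (f v) v" by blast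
  \<comment> \<open>The sum of the individual bounds dominates each of them and, unlike a maximum,
    is defined for empty \<open>V\<close>.\<close>
  have "word_le S (sum f V) v" if "v \<in> V" for v
    using f that assms(1) word_le_mono[of S "f v" v "sum f V" S]
    by (simp add: member_le_sum)
  then show ?thesis using that by blast
qed

lemma finite_word_le:
  assumes "finite S"
  shows "finite {g. word_le S n g}"
proof (induction n)
  case 0
  have "{g. word_le S 0 g} \<subseteq> {\<one>}" by (auto elim: word_le.cases)
  then show ?case using finite_subset by blast
next
  case (Suc n)
  let ?B = "{g. word_le S n g}"
  have "{g. word_le S (Suc n) g} \<subseteq> {\<one>} \<union> (\<lambda>(g, s). g \<otimes> s) ` (?B \<times> (S \<union> m_inv G ` S))"
    by (auto elim: word_le.cases)
  moreover have "finite \<dots>" using Suc assms by auto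
  ultimately show ?case by (rule finite_subset)
qed

lemma word_le_iff_list:
  assumes "S \<subseteq> carrier G"
  shows "word_le S n g \<longleftrightarrow>
    (\<exists>ws. length ws \<le> n \<and> set ws \<subseteq> S \<union> m_inv G ` S \<and> foldr (mult G) ws \<one> = g)"
    (is "_ \<longleftrightarrow> ?R n g")
proof
  \<comment> \<open>\<open>foldr\<close> brackets a word from its right end, whereas
    \<open>word_le\<close> appends letters there; this identity detaches the last letter.\<close>
  have app: "foldr (mult G) (ws @ [s]) \<one> = foldr (mult G) ws \<one> \<otimes> s"
    if "set ws \<subseteq> carrier G" "s \<in> carrier G" for ws s
  proof -
    have "foldr (mult G) us \<one> \<in> carrier G \<and> foldr (mult G) (us @ [s]) \<one> = foldr (mult G) us \<one> \<otimes> s"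
      if "set us \<subseteq> carrier G" for us
      using that \<open>s \<in> carrier G\<close> by (induction us) (auto simp: m_assoc)
    then show ?thesis using that by blast
  qed
  have snoc: "?R (Suc n) (g \<otimes> s)" if "?R n g" and s: "s \<in> S \<union> m_inv G ` S" for n g s
  proof -
    obtain ws where ws: "length ws \<le> n" "set ws \<subseteq> S \<union> m_inv G ` S" "foldr (mult G) ws \<one> = g"
      using \<open>?R n g\<close> by blast
    have "set ws \<subseteq> carrier G" "s \<in> carrier G" using ws s assms by auto
    then show ?thesis using ws s app[of ws s] by (intro exI[of _ "ws @ [s]"]) auto
  qed
  show "?R n g" if "word_le S n g"
    using that
  proof (induction rule: word_le.induct)
    case (one n) then show ?case by (intro exI[of _ "[]"]) auto
  qed (auto intro!: snoc)
next
  have left: "word_le S (Suc n) (s \<otimes> h)" if "s \<in> S \<union> m_inv G ` S" "word_le S n h" for s n h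
    using word_le_mult[of S n h "Suc 0" s] that assms word_le_gen[of _ S] word_le_inv by auto
  have "word_le S (length ws) (foldr (mult G) ws \<one>)" if "set ws \<subseteq> S \<union> m_inv G ` S" for ws
    using that by (induction ws) (auto intro: left word_le.one)
  then show "?R n g \<Longrightarrow> word_le S n g" using word_le_mono by blast
qed

text \<open>Membership in \<open>generate G S\<close> makes the set under \<open>LEAST\<close>
  nonempty, so the minimum is attained by an actual word.\<close>

lemma word_length_le_iff:
  assumes "S \<subseteq> carrier G" "g \<in> generate G S"
  shows "word_length G S g \<le> n \<longleftrightarrow> word_le S n g"
proof -
  have least: "(LEAST n. Q n) \<le> k \<longleftrightarrow> (\<exists>m\<le>k. Q m)" if "\<exists>m. Q m" for Q :: "nat \<Rightarrow> bool" and k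
    using LeastI_ex[OF that] Least_le[of Q] by (meson order_trans)
  have iff: "word_le S n g \<longleftrightarrow>
      (\<exists>m\<le>n. \<exists>ws. length ws = m \<and> set ws \<subseteq> S \<union> m_inv G ` S \<and> foldr (mult G) ws \<one> = g)" for n
    unfolding word_le_iff_list[OF assms(1)] by blast
  show ?thesis
    unfolding word_length_def iff
    using generate_imp_word_le[OF assms(2,1)] iff by (intro least) blast
qed

text \<open>Inverses in a subgroup agree with those of \<open>G\<close>, so lengths in subgroups can
  be computed in \<open>G\<close> itself.\<close>

lemma word_length_subgroup:
  assumes "subgroup K G" "S \<subseteq> K"
  shows "word_length (G\<lparr>carrier := K\<rparr>) S g = word_length G S g"
proof -
  have "m_inv (G\<lparr>carrier := K\<rparr>) ` S = m_inv G ` S"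
    using assms m_inv_consistent by (intro image_cong) auto
  then show ?thesis unfolding word_length_def by simp
qed

end

section \<open>Finite index and Schreier rewriting\<close>

context group begin

text \<open>Here \<open>\<tau>\<close> is an invariant with finitely many values that separates the
  cosets of \<open>R\<close>; one representative for each value that occurs gives
  \<open>F\<close>.\<close>

lemma finite_index_transversal:
  assumes "subgroup R G" "finite I" "\<And>x. x \<in> carrier G \<Longrightarrow> \<tau> x \<in> I"
    and "\<And>x y. x \<in> carrier G \<Longrightarrow> y \<in> carrier G \<Longrightarrow> \<tau> x = \<tau> y \<Longrightarrow> x \<otimes> inv y \<in> R"
  shows "\<exists>F. finite F \<and> F \<subseteq> carrier G \<and> (\<forall>x\<in>carrier G. \<exists>f\<in>F. x \<otimes> inv f \<in> R)"
proof -
  have "finite (\<tau> ` carrier G)" using assms(2,3) by (meson finite_subset image_subsetI)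
  then obtain F where F: "F \<subseteq> carrier G" "finite F" "\<tau> ` carrier G = \<tau> ` F"
    using finite_subset_image[of "\<tau> ` carrier G" \<tau> "carrier G"] by blast
  have "\<exists>f\<in>F. x \<otimes> inv f \<in> R" if "x \<in> carrier G" for x
  proof -
    have "\<tau> x \<in> \<tau> ` F" using F(3) that by blast
    then obtain f where "f \<in> F" "\<tau> x = \<tau> f" by blast
    then show ?thesis using assms(4) F(1) that by blast
  qed
  then show ?thesis using F by blast
qed

text \<open>The witness is the kernel of the action of \<^term>\<open>G\<close> by right translation on the finite set of
  all cosets of all members of the family.\<close>

lemma finite_index_normal_core:
  assumes "finite \<K>" "\<And>K. K \<in> \<K> \<Longrightarrow> subgroup K G \<and> finite (rcosets K)"
  shows "\<exists>R F. R \<lhd> G \<and> (\<forall>K\<in>\<K>. R \<subseteq> K) \<and> finite F \<and> F \<subseteq> carrier G \<and>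
    (\<forall>x\<in>carrier G. \<exists>f\<in>F. x \<otimes> inv f \<in> R)"
proof -
  define \<C> where "\<C> = (\<Union>K\<in>\<K>. rcosets K)"
  define R where "R = {x \<in> carrier G. \<forall>c\<in>\<C>. c #> x = c}"
  have fin: "finite \<C>" using assms by (auto simp: \<C>_def)
  have sub: "c \<subseteq> carrier G" if "c \<in> \<C>" for c
    using that assms subgroup.rcosets_carrier[OF _ is_group] unfolding \<C>_def by blast
  have stable: "c #> x \<in> \<C>" if "c \<in> \<C>" "x \<in> carrier G" for c x
  proof -
    from that obtain K a where K: "K \<in> \<K>" "a \<in> carrier G" "c = K #> a"
      by (auto simp: \<C>_def RCOSETS_def)
    have "K \<subseteq> carrier G" using assms(2) K(1) subgroup.subset by blast
    then have "c #> x = K #> (a \<otimes> x)"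
      unfolding K(3) using K(2) that(2) by (rule coset_mult_assoc)
    then show ?thesis using K that by (auto simp: \<C>_def RCOSETS_def)
  qed
  have sg: "subgroup R G"
  proof
    show "x \<otimes> y \<in> R" if "x \<in> R" "y \<in> R" for x y
      using that sub by (auto simp: R_def simp flip: coset_mult_assoc)
    show "inv x \<in> R" if "x \<in> R" for x
    proof -
      have x: "x \<in> carrier G" using that by (simp add: R_def)
      have "c #> inv x = c" if "c \<in> \<C>" for c
        using \<open>x \<in> R\<close> that sub[OF that] x coset_mult_assoc[of c x "inv x"] by (auto simp: R_def)
      then show ?thesis using x by (simp add: R_def)
    qed
  qed (use sub in \<open>auto simp: R_def\<close>)
  have "x \<otimes> h \<otimes> inv x \<in> R" if x: "x \<in> carrier G" "h \<in> R" for x h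
  proof -
    have h: "h \<in> carrier G" using that by (simp add: R_def)
    have "c #> (x \<otimes> h \<otimes> inv x) = c" if c: "c \<in> \<C>" for c
    proof -
      have "c #> (x \<otimes> h \<otimes> inv x) = c #> x #> h #> inv x"
        using sub[OF c] sub[OF stable[OF c x(1)]] x h
        by (simp add: coset_mult_assoc m_assoc)
      also have "c #> x #> h = c #> x" using stable[OF c x(1)] x(2) by (simp add: R_def)
      also have "c #> x #> inv x = c" using sub[OF c] x by (simp add: coset_mult_assoc)
      finally show ?thesis .
    qed
    then show ?thesis using x h by (simp add: R_def)
  qed
  then have "R \<lhd> G" using sg normal_inv_iff by blast
  \<comment> \<open>\<open>K\<close> is one of its own cosets, and an element whose translation
    fixes it lies in it.\<close>
  moreover have "R \<subseteq> K" if "K \<in> \<K>" for K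
  proof
    fix x assume "x \<in> R"
    have K: "subgroup K G" using assms that by blast
    then have "K #> \<one> \<in> \<C>" using that by (auto simp: \<C>_def RCOSETS_def)
    then have "K \<in> \<C>" using coset_mult_one[OF subgroup.subset[OF K]] by simp
    then show "x \<in> K" using \<open>x \<in> R\<close> K coset_join1 by (auto simp: R_def)
  qed
  moreover have "\<exists>F. finite F \<and> F \<subseteq> carrier G \<and> (\<forall>x\<in>carrier G. \<exists>f\<in>F. x \<otimes> inv f \<in> R)"
  \<comment> \<open>The invariant of \<open>x\<close> is its translation of \<open>\<C>\<close>,
    restricted to \<open>\<C>\<close> so that it lies in a finite set of extensional functions.
    Elements with equal translations differ by an element of the kernel \<open>R\<close>.\<close>
  proof (rule finite_index_transversal[OF sg])
    show "finite (\<C> \<rightarrow>\<^sub>E \<C>)" using fin by (simp add: finite_PiE)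
    show "(\<lambda>c\<in>\<C>. c #> x) \<in> \<C> \<rightarrow>\<^sub>E \<C>" if "x \<in> carrier G" for x using stable that by auto
    show "x \<otimes> inv y \<in> R" if x: "x \<in> carrier G" "y \<in> carrier G" "(\<lambda>c\<in>\<C>. c #> x) = (\<lambda>c\<in>\<C>. c #> y)" for x y
    proof -
      have "c #> (x \<otimes> inv y) = c" if c: "c \<in> \<C>" for c
      proof -
        have "c #> x = c #> y" using fun_cong[OF x(3), of c] c by simp
        then have "c #> x #> inv y = c #> y #> inv y" by simp
        then show ?thesis using sub[OF c] x by (simp add: coset_mult_assoc)
      qed
      then show ?thesis using x by (simp add: R_def)
    qed
  qed
  ultimately show ?thesis by blast
qed

text \<open>As in Schreier's lemma, a prefix of the word is kept in the form \<open>z \<otimes> c \<otimes> f\<close> with \<open>c\<close> a word in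
  \<^term>\<open>V\<close> and \<open>f\<close> in the transversal; each new letter contributes one conjugate \<open>c \<otimes> w \<otimes> inv c\<close>.\<close>

lemma Schreier_rewriting:
  assumes A: "subgroup A G" and N: "subgroup N G" "N \<subseteq> A" and K: "subgroup K G" "K \<subseteq> A"
    and KN: "\<And>k n. k \<in> K \<Longrightarrow> n \<in> N \<Longrightarrow> k \<otimes> n \<otimes> inv k \<in> N"
    and S: "finite S" "S \<subseteq> A"
    and F: "finite F" "F \<subseteq> carrier G"
    and cover: "\<And>a. a \<in> A \<Longrightarrow> \<exists>n\<in>N. \<exists>k\<in>K. \<exists>f\<in>F. a = n \<otimes> k \<otimes> f"
  obtains V W where "finite V" "V \<subseteq> K" "finite W" "W \<subseteq> N"
    "\<And>n a. word_le S n a \<Longrightarrow> a \<in> N <#> K \<Longrightarrow>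
      \<exists>z c. a = z \<otimes> c \<and> word_le V (Suc n) c \<and>
        word_le {v \<otimes> w \<otimes> inv v | v w. w \<in> W \<and> word_le V n v} (Suc n) z"
proof -
  \<comment> \<open>\<open>\<one>\<close> is the transversal part of the empty prefix; intersecting
    with \<open>A\<close> keeps products with letters inside \<open>A\<close>.\<close>
  define F1 where "F1 = insert \<one> (F \<inter> A)"
  have F1: "finite F1" "F1 \<subseteq> A" using F A by (auto simp: F1_def subgroup.one_closed)
  have AC: "A \<subseteq> carrier G" and NC: "N \<subseteq> carrier G" and KC: "K \<subseteq> carrier G"
    using assms subgroup.subset by blast+
  note mem = subgroup.m_closed[OF A] subgroup.m_inv_closed[OF A]
  have cover1: "\<exists>n k f. n \<in> N \<and> k \<in> K \<and> f \<in> F1 \<and> a = n \<otimes> k \<otimes> f" if a: "a \<in> A" for a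
  proof -
    obtain n k f where h: "n \<in> N" "k \<in> K" "f \<in> F" "a = n \<otimes> k \<otimes> f" using cover[OF a] by blast
    have "n \<in> carrier G" "k \<in> carrier G" "f \<in> carrier G" using h F NC KC by auto
    then have "f = inv (n \<otimes> k) \<otimes> a" using h(4) by simp
    moreover have "inv (n \<otimes> k) \<otimes> a \<in> A" using h(1,2) a N(2) K(2) by (intro mem) auto
    ultimately have "f \<in> A" by simp
    then show ?thesis using h by (auto simp: F1_def)
  qed
  \<comment> \<open>A transversal element followed by one letter: these finitely many products are
    all that has to be split before the last step.\<close>
  define P where "P = (\<lambda>(f, s). f \<otimes> s) ` (F1 \<times> (S \<union> m_inv G ` S))"
  have P: "finite P" "P \<subseteq> A" using F1 S by (auto simp: P_def intro!: mem)
  have "\<exists>\<nu> \<kappa> \<phi>. \<forall>a\<in>A. \<nu> a \<in> N \<and> \<kappa> a \<in> K \<and> \<phi> a \<in> F1 \<and> a = \<nu> a \<otimes> \<kappa> a \<otimes> \<phi> a"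
    using cover1 by metis
  then obtain \<nu> \<kappa> \<phi> where split: "\<And>a. a \<in> A \<Longrightarrow> \<nu> a \<in> N"
    "\<And>a. a \<in> A \<Longrightarrow> \<kappa> a \<in> K" "\<And>a. a \<in> A \<Longrightarrow> \<phi> a \<in> F1"
    "\<And>a. a \<in> A \<Longrightarrow> a = \<nu> a \<otimes> \<kappa> a \<otimes> \<phi> a" by blast
  \<comment> \<open>The final transversal part must be absorbed as well. When it lies in
    \<open>N <#> K\<close>, it is split a second way, without a remainder.\<close>
  have "\<forall>a\<in>F1 \<inter> (N <#> K). \<exists>n k. n \<in> N \<and> k \<in> K \<and> a = n \<otimes> k"
    by (auto simp: set_mult_def)
  then obtain \<nu>' \<kappa>' where split': "\<And>a. a \<in> F1 \<inter> (N <#> K) \<Longrightarrow> \<nu>' a \<in> N"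
    "\<And>a. a \<in> F1 \<inter> (N <#> K) \<Longrightarrow> \<kappa>' a \<in> K"
    "\<And>a. a \<in> F1 \<inter> (N <#> K) \<Longrightarrow> a = \<nu>' a \<otimes> \<kappa>' a" by metis
  define V where "V = \<kappa> ` P \<union> \<kappa>' ` (F1 \<inter> (N <#> K))"
  define W where "W = \<nu> ` P \<union> \<nu>' ` (F1 \<inter> (N <#> K))"
  define Z where "Z n = {v \<otimes> w \<otimes> inv v | v w. w \<in> W \<and> word_le V n v}" for n
  have V: "finite V" "V \<subseteq> K" and W: "finite W" "W \<subseteq> N"
    using P F1 split split' by (auto simp: V_def W_def)
  have VC: "V \<subseteq> carrier G" and WC: "W \<subseteq> carrier G" using V W KC NC by auto
  have ZN: "Z n \<subseteq> N" for n
    using KN W(2) word_le_subgroup[OF _ V(2) K(1)] by (auto simp: Z_def)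
  have Zmono: "Z n \<subseteq> Z m" if "n \<le> m" for n m
    using that word_le_mono[of V _ _ m V] by (fastforce simp: Z_def)
  have Z_step: "word_le (Z m) (Suc n) (z \<otimes> (c \<otimes> w \<otimes> inv c))"
    if "word_le (Z n) n z" "word_le V n c" "w \<in> W" "n \<le> m" for n m z c w
  proof -
    have "c \<otimes> w \<otimes> inv c \<in> Z n" using that unfolding Z_def by blast
    then have "c \<otimes> w \<otimes> inv c \<in> Z m" using Zmono that(4) by blast
    moreover have "word_le (Z m) n z" using that Zmono word_le_mono by blast
    ultimately show ?thesis by (rule word_le.mult[rotated])
  qed
  \<comment> \<open>Split \<open>f \<otimes> s\<close> by \<open>\<nu>\<close>,
    \<open>\<kappa>\<close> and \<open>\<phi>\<close>. Moving the \<open>\<nu>\<close> part to the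
    left of \<open>c\<close> turns it into its conjugate by \<open>c\<close>, which joins
    \<open>z\<close>, while the \<open>\<kappa>\<close> part extends \<open>c\<close>.\<close>
  have step: "\<exists>z' c' f'. z \<otimes> c \<otimes> f \<otimes> s = z' \<otimes> c' \<otimes> f' \<and> f' \<in> F1 \<and> word_le V (Suc n) c' \<and>
      word_le (Z (Suc n)) (Suc n) z'"
    if h: "f \<in> F1" "s \<in> S \<union> m_inv G ` S" "word_le V n c" "word_le (Z n) n z" for z c f s n
  proof -
    have p: "f \<otimes> s \<in> P" using h by (auto simp: P_def)
    then have pA: "f \<otimes> s \<in> A" using P by auto
    have k: "\<kappa> (f \<otimes> s) \<in> V" "\<nu> (f \<otimes> s) \<in> W" using p by (auto simp: V_def W_def)
    have s: "s \<in> carrier G" using h S AC by auto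
    have f: "f \<in> carrier G" "\<phi> (f \<otimes> s) \<in> carrier G"
      using h F1 AC split(3)[OF pA] by auto
    have c: "c \<in> carrier G" "z \<in> carrier G" using h VC ZN NC word_le_closed by blast+
    have "z \<otimes> c \<otimes> f \<otimes> s = z \<otimes> c \<otimes> (\<nu> (f \<otimes> s) \<otimes> \<kappa> (f \<otimes> s) \<otimes> \<phi> (f \<otimes> s))"
      using split(4)[OF pA] c f s by (metis m_assoc m_closed)
    also have "\<dots> = (z \<otimes> (c \<otimes> \<nu> (f \<otimes> s) \<otimes> inv c)) \<otimes> (c \<otimes> \<kappa> (f \<otimes> s)) \<otimes> \<phi> (f \<otimes> s)"
      using c f k VC WC by (simp add: m_assoc subset_iff)
    finally show ?thesis
      using split(3)[OF pA] word_le.mult[OF h(3) k(1)] Z_step[OF h(4,3) k(2) le_SucI[OF order_refl]]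
      by blast
  qed
  have main: "\<exists>z c f. a = z \<otimes> c \<otimes> f \<and> f \<in> F1 \<and> word_le V n c \<and> word_le (Z n) n z"
    if "word_le S n a" for n a
    using that
  proof (induction rule: word_le.induct)
    case (one n)
    show ?case by (rule exI[of _ \<one>], rule exI[of _ \<one>], rule exI[of _ \<one>])
        (auto simp: F1_def intro: word_le.one)
  next
    case (mult n g s)
    then obtain z c f where "g = z \<otimes> c \<otimes> f" "f \<in> F1" "word_le V n c" "word_le (Z n) n z" by blast
    then show ?case using step[of f s n c z] mult by blast
  next
    case (mult_inv n g s)
    then obtain z c f where "g = z \<otimes> c \<otimes> f" "f \<in> F1" "word_le V n c" "word_le (Z n) n z" by blast
    then show ?case using step[of f "inv s" n c z] mult_inv by blast
  qed
  have "\<exists>z c. a = z \<otimes> c \<and> word_le V (Suc n) c \<and> word_le (Z n) (Suc n) z"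
    if a: "word_le S n a" "a \<in> N <#> K" for n a
  proof -
    obtain z c f where h: "a = z \<otimes> c \<otimes> f" "f \<in> F1" "word_le V n c" "word_le (Z n) n z"
      using main[OF a(1)] by blast
    obtain n0 k0 where nk: "n0 \<in> N" "k0 \<in> K" "a = n0 \<otimes> k0" using a by (auto simp: set_mult_def)
    have c: "c \<in> K" "z \<in> N" using h ZN V(2) word_le_subgroup K(1) N(1) by blast+
    have carr: "c \<in> carrier G" "z \<in> carrier G" "f \<in> carrier G" "n0 \<in> carrier G" "k0 \<in> carrier G"
      using c nk h F1 AC NC KC by auto
    \<comment> \<open>Solving for \<open>f\<close> shows that it lies in \<open>N <#> K\<close>,
      because \<open>K\<close> normalizes \<open>N\<close>. Hence it splits without remainder, and
      this extra letter is the reason for \<open>Suc n\<close>.\<close>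
    have "f = inv c \<otimes> (inv z \<otimes> a)" using carr h(1) by (simp add: m_assoc)
    also have "\<dots> = (inv c \<otimes> (inv z \<otimes> n0) \<otimes> inv (inv c)) \<otimes> (inv c \<otimes> k0)"
      using carr nk(3) by (simp add: m_assoc)
    also have "\<dots> \<in> N <#> K"
    proof -
      have "inv z \<otimes> n0 \<in> N" "inv c \<in> K" "inv c \<otimes> k0 \<in> K"
        using c nk N K by (auto intro: subgroup.m_closed subgroup.m_inv_closed)
      then show ?thesis using KN unfolding set_mult_def by blast
    qed
    finally have f: "f \<in> F1 \<inter> (N <#> K)" using h by blast
    have k: "\<kappa>' f \<in> V" "\<nu>' f \<in> W" using f by (auto simp: V_def W_def)
    have "a = z \<otimes> c \<otimes> (\<nu>' f \<otimes> \<kappa>' f)" using h(1) split'(3)[OF f] by simp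
    also have "\<dots> = (z \<otimes> (c \<otimes> \<nu>' f \<otimes> inv c)) \<otimes> (c \<otimes> \<kappa>' f)"
      using carr k VC WC by (simp add: m_assoc subset_iff)
    finally show ?thesis
      using word_le.mult[OF h(3) k(1)] Z_step[OF h(4,3) k(2) order_refl] by blast
  qed
  then show ?thesis using V W that unfolding Z_def by blast
qed

end

section \<open>Linked families of subgroups\<close>

text \<open>Each representative in \<open>F\<close> whose coset of \<open>P\<close> meets
  \<open>A\<close> is replaced by a point of \<open>A\<close> in that coset.\<close>

lemma (in group) subgroup_transversal:
  assumes P: "subgroup P G" and A: "subgroup A G"
    and F: "finite F" "F \<subseteq> carrier G" "\<And>x. x \<in> carrier G \<Longrightarrow> \<exists>f\<in>F. x \<otimes> inv f \<in> P"
  shows "\<exists>E. finite E \<and> E \<subseteq> A \<and> (\<forall>a\<in>A. \<exists>e\<in>E. a \<otimes> inv e \<in> P)"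
proof -
  define F' where "F' = {f \<in> F. \<exists>a\<in>A. a \<otimes> inv f \<in> P}"
  have "\<forall>f\<in>F'. \<exists>a. a \<in> A \<and> a \<otimes> inv f \<in> P" by (auto simp: F'_def)
  then obtain r where r: "\<And>f. f \<in> F' \<Longrightarrow> r f \<in> A" "\<And>f. f \<in> F' \<Longrightarrow> r f \<otimes> inv f \<in> P" by metis
  have "\<exists>e\<in>r ` F'. a \<otimes> inv e \<in> P" if a: "a \<in> A" for a
  proof -
    have aC: "a \<in> carrier G" using a A subgroup.subset by blast
    then obtain f where f: "f \<in> F" "a \<otimes> inv f \<in> P" using F(3) by blast
    then have f': "f \<in> F'" using a by (auto simp: F'_def)
    have C: "f \<in> carrier G" "r f \<in> carrier G" using f F(2) r(1)[OF f'] A subgroup.subset by blast+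
    have "(a \<otimes> inv f) \<otimes> inv (r f \<otimes> inv f) \<in> P"
      using f r(2)[OF f'] P by (auto intro: subgroup.m_closed subgroup.m_inv_closed)
    then have "a \<otimes> inv (r f) \<in> P" using C aC by (simp add: m_assoc inv_mult_group)
    then show ?thesis using f' by blast
  qed
  moreover have "finite (r ` F')" "r ` F' \<subseteq> A" using F(1) r(1) by (auto simp: F'_def)
  ultimately show ?thesis by blast
qed

text \<open>Finite index of \<open>P\<close> is expressed by the finite set \<open>F\<close> of
  representatives, and \<open>D\<close> is a common bound for the distortion of all
  \<open>A \<inter> H\<close> in \<open>A\<close>. The covering condition is stated apart from the
  links, since a chain of one member has no link to supply it.\<close>

locale linked_family = normal H G for H and G (structure) +
  fixes P F :: "'a set" and \<A> :: "'a set set" and SA TA :: "'a set \<Rightarrow> 'a set" and D :: "nat \<Rightarrow> nat"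
  assumes P_normal: "P \<lhd> G" and H_P: "H \<subseteq> P"
    and F_finite: "finite F" and F_carrier: "F \<subseteq> carrier G"
    and F_cover: "x \<in> carrier G \<Longrightarrow> \<exists>f\<in>F. x \<otimes> inv f \<in> P"
    and family_subgroup: "A \<in> \<A> \<Longrightarrow> subgroup A G"
    and family_generate: "generate G (\<Union>\<A>) = carrier G"
    and family_cover: "A \<in> \<A> \<Longrightarrow> P \<subseteq> H <#> A"
    and family_linked: "A \<in> \<A> \<Longrightarrow> A' \<in> \<A> \<Longrightarrow>
      \<exists>As. As \<noteq> [] \<and> set As \<subseteq> \<A> \<and> hd As = A \<and> last As = A' \<and>
        (\<forall>i. Suc i < length As \<longrightarrow> P \<subseteq> H <#> (As ! i \<inter> As ! Suc i))"
    and SA_finite: "A \<in> \<A> \<Longrightarrow> finite (SA A)"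
    and SA_generate: "A \<in> \<A> \<Longrightarrow> generate G (SA A) = A"
    and TA_finite: "A \<in> \<A> \<Longrightarrow> finite (TA A)"
    and TA_subset: "A \<in> \<A> \<Longrightarrow> TA A \<subseteq> A \<inter> H"
    and D_mono: "mono D"
    and D_bound: "A \<in> \<A> \<Longrightarrow> h \<in> A \<inter> H \<Longrightarrow> word_le (SA A) n h \<Longrightarrow> word_le (TA A) (D n) h"
begin

section \<open>Carriers and the bookkeeping of costs\<close>

lemma P_subgroup: "subgroup P G"
  using P_normal normal_imp_subgroup by blast

lemma SA_subset: "A \<in> \<A> \<Longrightarrow> SA A \<subseteq> A"
  using generate.incl[of _ "SA A" G] SA_generate[of A] by blast

lemma SA_carrier: "A \<in> \<A> \<Longrightarrow> SA A \<subseteq> carrier G"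
  using SA_subset subgroup.subset[OF family_subgroup] by blast

lemma family_carrier: "A \<in> \<A> \<Longrightarrow> A \<subseteq> carrier G"
  using subgroup.subset[OF family_subgroup] .

text \<open>\<open>C\<close> acts both as a factor and as a scale inside \<open>D\<close>, like the
  constants \<open>A\<close> and \<open>B\<close> of domination. The two \<open>Suc\<close> absorb
  additive constants, so that sums and rescalings of such bounds are again bounded by this
  shape.\<close>

definition cost :: "nat \<Rightarrow> nat \<Rightarrow> nat" where
  "cost C n = C * Suc (D (C * Suc n))"

lemma cost_mono: "C \<le> C' \<Longrightarrow> n \<le> n' \<Longrightarrow> cost C n \<le> cost C' n'"
  unfolding cost_def by (intro mult_le_mono Suc_leI le_imp_less_Suc monoD[OF D_mono]) auto

lemma cost_scale: "cost C (a * n) \<le> cost (C * Suc a) n"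
proof -
  have "C * Suc (a * n) \<le> C * Suc a * Suc n"
    unfolding mult.assoc by (rule mult_le_mono2) simp
  then have "D (C * Suc (a * n)) \<le> D (C * Suc a * Suc n)" by (rule monoD[OF D_mono])
  then show ?thesis unfolding cost_def by (intro mult_le_mono) auto
qed

lemma cost_add: "cost C n + cost C' n \<le> cost (C + C') n"
proof -
  have "cost C n \<le> C * Suc (D ((C + C') * Suc n))" "cost C' n \<le> C' * Suc (D ((C + C') * Suc n))"
    unfolding cost_def
    by (intro mult_le_mono le_imp_less_Suc Suc_leI monoD[OF D_mono] le_refl; simp)+
  then show ?thesis unfolding cost_def[of "C + C'"] add_mult_distrib by linarith
qed

text \<open>Schreier rewriting for \<open>N = B \<inter> H\<close> and
  \<open>K = L \<inter> P\<close>. It is applied with \<open>B = A\<close> and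
  \<open>L = A \<inter> A'\<close> for a link, and with \<open>B = carrier G\<close> and
  \<open>L = A\<close> for the final estimate.\<close>

lemma rewriting:
  assumes "A \<in> \<A>" "subgroup L G" "subgroup B G" "L \<subseteq> B" "P \<subseteq> H <#> L" "finite S" "S \<subseteq> B"
  obtains V W where "finite V" "V \<subseteq> L \<inter> P" "finite W" "W \<subseteq> B \<inter> H"
    "\<And>n a. word_le S n a \<Longrightarrow> a \<in> B \<inter> P \<Longrightarrow>
      \<exists>z c. a = z \<otimes> c \<and> word_le V (Suc n) c \<and>
        word_le {v \<otimes> w \<otimes> inv v | v w. w \<in> W \<and> word_le V n v} (Suc n) z"
proof -
  \<comment> \<open>In \<open>x = h \<otimes> c\<close> the factor
    \<open>h = x \<otimes> inv c\<close> lies in \<open>B\<close> since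
    \<open>L \<subseteq> B\<close>, and \<open>c = inv h \<otimes> x\<close> lies in
    \<open>P\<close> since \<open>H \<subseteq> P\<close>.\<close>
  have BP: "B \<inter> P \<subseteq> (B \<inter> H) <#> (L \<inter> P)"
  proof
    fix x assume x: "x \<in> B \<inter> P"
    then obtain h c where hc: "h \<in> H" "c \<in> L" "x = h \<otimes> c" using assms(5) by (auto simp: set_mult_def)
    have C: "x \<in> carrier G" "h \<in> carrier G" "c \<in> carrier G"
      using x hc assms(2) P_subgroup subgroup.subset subset by blast+
    have "h = x \<otimes> inv c" "c = inv h \<otimes> x" using C hc by (simp_all add: m_assoc)
    moreover have "x \<otimes> inv c \<in> B"
      using x hc(2) assms(4) by (intro subgroup.m_closed[OF assms(3)] subgroup.m_inv_closed[OF assms(3)]) auto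
    moreover have "inv h \<otimes> x \<in> P"
      using x hc(1) H_P by (intro subgroup.m_closed[OF P_subgroup] subgroup.m_inv_closed[OF P_subgroup]) auto
    ultimately have "h \<in> B \<inter> H" "c \<in> L \<inter> P" using hc(1,2) by auto
    then show "x \<in> (B \<inter> H) <#> (L \<inter> P)" unfolding hc(3) set_mult_def by blast
  qed
  obtain E where E: "finite E" "E \<subseteq> B" "\<And>a. a \<in> B \<Longrightarrow> \<exists>e\<in>E. a \<otimes> inv e \<in> P"
    using subgroup_transversal[OF P_subgroup assms(3) F_finite F_carrier F_cover] by blast
  have BC: "B \<subseteq> carrier G" using assms(3) subgroup.subset by blast
  have cover: "\<exists>n\<in>B \<inter> H. \<exists>k\<in>L \<inter> P. \<exists>f\<in>E. a = n \<otimes> k \<otimes> f" if a: "a \<in> B" for a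
  proof -
    obtain e where e: "e \<in> E" "a \<otimes> inv e \<in> P" using E(3)[OF a] by blast
    have "a \<otimes> inv e \<in> B"
      using e a E assms(3) by (auto intro!: subgroup.m_closed subgroup.m_inv_closed)
    then obtain n k where nk: "n \<in> B \<inter> H" "k \<in> L \<inter> P" "a \<otimes> inv e = n \<otimes> k"
      using BP e by (auto simp: set_mult_def)
    have "a = (a \<otimes> inv e) \<otimes> e" using a e E BC by (auto simp: m_assoc subset_iff)
    then show ?thesis using nk e by auto
  qed
  have conj: "k \<otimes> n \<otimes> inv k \<in> B \<inter> H" if "k \<in> L \<inter> P" "n \<in> B \<inter> H" for k n
  proof -
    have "k \<in> B" "k \<in> carrier G" using that assms(2,4) BC by auto
    then show ?thesis using that assms(3) inv_op_closed2
      by (auto intro!: subgroup.m_closed subgroup.m_inv_closed)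
  qed
  have sub: "subgroup (B \<inter> H) G" "subgroup (L \<inter> P) G"
    using assms(2,3) P_subgroup subgroup_axioms by (auto intro: subgroups_Inter_pair)
  have incl: "L \<inter> P \<subseteq> B" "E \<subseteq> carrier G" using assms(4) E(2) BC by auto
  show ?thesis
  proof (rule Schreier_rewriting[of B "B \<inter> H" "L \<inter> P" S E])
    show "k \<otimes> n \<otimes> inv k \<in> B \<inter> H" if "k \<in> L \<inter> P" "n \<in> B \<inter> H" for k n
      using that by (rule conj)
    show "\<exists>n\<in>B \<inter> H. \<exists>k\<in>L \<inter> P. \<exists>f\<in>E. a = n \<otimes> k \<otimes> f" if "a \<in> B" for a
      using that by (rule cover)
  next
    fix V W assume VW: "finite V" "V \<subseteq> L \<inter> P" "finite W" "W \<subseteq> B \<inter> H"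
      and rew: "\<And>n a. word_le S n a \<Longrightarrow> a \<in> (B \<inter> H) <#> (L \<inter> P) \<Longrightarrow>
      \<exists>z c. a = z \<otimes> c \<and> word_le V (Suc n) c \<and>
        word_le {v \<otimes> w \<otimes> inv v | v w. w \<in> W \<and> word_le V n v} (Suc n) z"
    show thesis
    proof (rule that[OF VW])
      fix n a assume "word_le S n a" "a \<in> B \<inter> P"
      then show "\<exists>z c. a = z \<otimes> c \<and> word_le V (Suc n) c \<and>
          word_le {v \<otimes> w \<otimes> inv v | v w. w \<in> W \<and> word_le V n v} (Suc n) z"
        using BP by (intro rew) auto
    qed
  qed (fact assms(3,6,7) sub incl E(1) Int_lower1)+
qed

text \<open>Conjugating by \<^term>\<open>g\<close> takes elements of \<^term>\<open>A \<inter> P\<close> to elements of \<^term>\<open>A' \<inter> P\<close> of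
  comparable length, up to a cheap element of \<^term>\<open>H\<close>.\<close>

definition transport :: "'a set \<Rightarrow> 'a set \<Rightarrow> 'a \<Rightarrow> bool" where
  "transport A A' g \<longleftrightarrow> g \<in> carrier G \<and> (\<exists>U C. finite U \<and> U \<subseteq> H \<and>
     (\<forall>n b. b \<in> A \<inter> P \<longrightarrow> word_le (SA A) n b \<longrightarrow>
       (\<exists>k b'. b \<otimes> g = k \<otimes> g \<otimes> b' \<and> b' \<in> A' \<inter> P \<and>
          word_le (SA A') (C * Suc n) b' \<and> word_le U (cost C n) k)))"

text \<open>First \<open>b\<close> is pushed past \<open>g\<close>, leaving \<open>c\<close>, then
  \<open>c\<close> past \<open>g'\<close>. The error \<open>l\<close> of the second move stands to
  the right of \<open>g\<close> and gets conjugated by it, which is harmless as \<open>H\<close> is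
  normal and \<open>g\<close> is fixed.\<close>

lemma transport_mult:
  assumes "A \<in> \<A>" "A' \<in> \<A>" "A'' \<in> \<A>" "transport A A' g" "transport A' A'' g'"
  shows "transport A A'' (g \<otimes> g')"
proof -
  have g: "g \<in> carrier G" "g' \<in> carrier G" using assms by (auto simp: transport_def)
  obtain U C where U: "finite U" "U \<subseteq> H"
    "\<And>n b. b \<in> A \<inter> P \<Longrightarrow> word_le (SA A) n b \<Longrightarrow>
       \<exists>k b'. b \<otimes> g = k \<otimes> g \<otimes> b' \<and> b' \<in> A' \<inter> P \<and>
          word_le (SA A') (C * Suc n) b' \<and> word_le U (cost C n) k"
    using assms(4) unfolding transport_def by blast
  obtain U' C' where U': "finite U'" "U' \<subseteq> H"
    "\<And>n b. b \<in> A' \<inter> P \<Longrightarrow> word_le (SA A') n b \<Longrightarrow>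
       \<exists>k b'. b \<otimes> g' = k \<otimes> g' \<otimes> b' \<and> b' \<in> A'' \<inter> P \<and>
          word_le (SA A'') (C' * Suc n) b' \<and> word_le U' (cost C' n) k"
    using assms(5) unfolding transport_def by blast
  define U'' where "U'' = U \<union> (\<lambda>u. g \<otimes> u \<otimes> inv g) ` U'"
  \<comment> \<open>The second move starts from length \<open>C * Suc n\<close>, so its bound is at
    most \<open>C' * Suc C * Suc n\<close>; the summand \<open>C\<close> pays for the first
    error.\<close>
  define C'' where "C'' = C + C' * Suc C"
  have U'': "finite U''" "U'' \<subseteq> H" using U U' inv_op_closed2[OF g(1)] by (auto simp: U''_def)
  have UC: "U \<subseteq> carrier G" "U' \<subseteq> carrier G" "U'' \<subseteq> carrier G" using U U' U'' subset by auto
  have "\<exists>k b'. b \<otimes> (g \<otimes> g') = k \<otimes> (g \<otimes> g') \<otimes> b' \<and> b' \<in> A'' \<inter> P \<and>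
          word_le (SA A'') (C'' * Suc n) b' \<and> word_le U'' (cost C'' n) k"
    if b: "b \<in> A \<inter> P" "word_le (SA A) n b" for n b
  proof -
    obtain k c where k: "b \<otimes> g = k \<otimes> g \<otimes> c" "c \<in> A' \<inter> P" "word_le (SA A') (C * Suc n) c"
      "word_le U (cost C n) k" using U(3)[OF b] by blast
    obtain l d where l: "c \<otimes> g' = l \<otimes> g' \<otimes> d" "d \<in> A'' \<inter> P"
      "word_le (SA A'') (C' * Suc (C * Suc n)) d" "word_le U' (cost C' (C * Suc n)) l"
      using U'(3)[OF k(2,3)] by blast
    have "C' * Suc (C * Suc n) \<le> C' * (Suc C * Suc n)" by (intro mult_le_mono2) simp
    also have "\<dots> \<le> C'' * Suc n" unfolding C''_def add_mult_distrib mult.assoc by simp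
    finally have len: "C' * Suc (C * Suc n) \<le> C'' * Suc n" .
    have "C' * Suc (D (C' * Suc (C * Suc n))) \<le> C' * Suc C * Suc (D (C'' * Suc n))"
      using monoD[OF D_mono len] by (intro mult_le_mono) auto
    moreover have "cost C n \<le> C * Suc (D (C'' * Suc n))"
      unfolding cost_def C''_def by (intro mult_le_mono2 Suc_leI le_imp_less_Suc monoD[OF D_mono] mult_le_mono1) simp
    ultimately have total: "cost C' (C * Suc n) + cost C n \<le> cost C'' n"
      unfolding cost_def[of C'] cost_def[of C''] by (subst C''_def) (simp only: add_mult_distrib)
    have carr: "k \<in> carrier G" "l \<in> carrier G" "c \<in> carrier G" "d \<in> carrier G" "b \<in> carrier G"
      using word_le_closed[OF k(4) UC(1)] word_le_closed[OF l(4) UC(2)] k(2) l(2) b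
        family_carrier assms by auto
    have "b \<otimes> (g \<otimes> g') = k \<otimes> g \<otimes> (c \<otimes> g')" using k(1) carr g by (metis m_assoc m_closed)
    also have "\<dots> = (k \<otimes> (g \<otimes> l \<otimes> inv g)) \<otimes> (g \<otimes> g') \<otimes> d"
      unfolding l(1) using carr g by (simp add: m_assoc)
    finally have "b \<otimes> (g \<otimes> g') = (k \<otimes> (g \<otimes> l \<otimes> inv g)) \<otimes> (g \<otimes> g') \<otimes> d" .
    moreover have "word_le U'' (cost C'' n) (k \<otimes> (g \<otimes> l \<otimes> inv g))"
    proof (rule word_le_mono[OF _ total order_refl], subst add.commute, rule word_le_mult)
      show "word_le U'' (cost C' (C * Suc n)) (g \<otimes> l \<otimes> inv g)"
        using word_le_conj[OF l(4) g(1) UC(2)] by (rule word_le_mono) (auto simp: U''_def)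
      show "word_le U'' (cost C n) k" using k(4) by (rule word_le_mono) (auto simp: U''_def)
    qed (rule UC)
    moreover have "word_le (SA A'') (C'' * Suc n) d" using l(3) len by (rule word_le_mono) auto
    ultimately show ?thesis using l(2) by blast
  qed
  then show ?thesis using U'' g unfolding transport_def by blast
qed

text \<open>Both \<open>A\<close> and the normal subgroup \<open>P\<close> are stable under
  conjugation by \<open>g\<close>, so no error in \<open>H\<close> occurs and the length grows by at
  most \<open>2 * m\<close>.\<close>

lemma transport_self:
  assumes "A \<in> \<A>" "g \<in> A"
  shows "transport A A g"
proof -
  have gC: "g \<in> carrier G" using assms family_carrier by blast
  obtain m where m: "word_le (SA A) m g"
    using generate_imp_word_le SA_carrier SA_generate assms by blast
  have "\<exists>k b'. b \<otimes> g = k \<otimes> g \<otimes> b' \<and> b' \<in> A \<inter> P \<and>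
          word_le (SA A) ((2 * m + 1) * Suc n) b' \<and> word_le {} (cost (2 * m + 1) n) k"
    if b: "b \<in> A \<inter> P" "word_le (SA A) n b" for n b
  proof (intro exI conjI)
    have bC: "b \<in> carrier G" using b assms family_carrier by blast
    show "b \<otimes> g = \<one> \<otimes> g \<otimes> (inv g \<otimes> b \<otimes> g)" using bC gC by (simp add: m_assoc)
    have "inv g \<otimes> b \<otimes> g \<in> A"
      using assms b family_subgroup by (auto intro!: subgroup.m_closed subgroup.m_inv_closed)
    moreover have "inv g \<otimes> b \<otimes> g \<in> P" using normal.inv_op_closed1[OF P_normal gC] b by blast
    ultimately show "inv g \<otimes> b \<otimes> g \<in> A \<inter> P" by blast
    have "word_le (SA A) (m + (n + m)) (inv g \<otimes> b \<otimes> g)"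
      using m b SA_carrier[OF assms(1)] word_le_inv[OF m] by (metis add.commute word_le_mult)
    then show "word_le (SA A) ((2 * m + 1) * Suc n) (inv g \<otimes> b \<otimes> g)"
      by (rule word_le_mono) auto
  qed (rule word_le.one)
  then show ?thesis unfolding transport_def using gC by blast
qed

lemma transport_one: "A \<in> \<A> \<Longrightarrow> transport A A \<one>"
  by (rule transport_self[OF _ subgroup.one_closed[OF family_subgroup]])

text \<open>Rewriting gives \<open>b = z \<otimes> c\<close> with \<open>c\<close> a word of linear
  length in a finite subset of \<open>A \<inter> A'\<close>, hence of linear length over both
  \<open>SA A\<close> and \<open>SA A'\<close>. So \<open>z = b \<otimes> inv c\<close> is an
  element of \<open>A \<inter> H\<close> of linear length over \<open>SA A\<close>, and
  \<open>D\<close> bounds its length over \<open>TA A\<close>.\<close>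

lemma transport_link:
  assumes A: "A \<in> \<A>" "A' \<in> \<A>" "P \<subseteq> H <#> (A \<inter> A')"
  shows "transport A A' \<one>"
proof -
  have sub: "subgroup (A \<inter> A') G" using A family_subgroup subgroups_Inter_pair by blast
  obtain V W where V: "finite V" "V \<subseteq> (A \<inter> A') \<inter> P" and W: "finite W" "W \<subseteq> A \<inter> H"
    and rew: "\<And>n a. word_le (SA A) n a \<Longrightarrow> a \<in> A \<inter> P \<Longrightarrow>
      \<exists>z c. a = z \<otimes> c \<and> word_le V (Suc n) c \<and>
        word_le {v \<otimes> w \<otimes> inv v | v w. w \<in> W \<and> word_le V n v} (Suc n) z"
    by (rule rewriting[OF A(1) sub family_subgroup[OF A(1)] Int_lower1 A(3)
        SA_finite[OF A(1)] SA_subset[OF A(1)]]) (rule that; assumption)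
  note S = SA_carrier[OF A(1)] SA_carrier[OF A(2)]
  obtain m1 where m1: "\<And>v. v \<in> V \<Longrightarrow> word_le (SA A) m1 v"
    using word_le_uniform[OF V(1) _ S(1)] V(2) SA_generate[OF A(1)] by blast
  obtain m2 where m2: "\<And>v. v \<in> V \<Longrightarrow> word_le (SA A') m2 v"
    using word_le_uniform[OF V(1) _ S(2)] V(2) SA_generate[OF A(2)] by blast
  define C where "C = Suc (m1 + m2)"
  have "\<exists>k b'. b \<otimes> \<one> = k \<otimes> \<one> \<otimes> b' \<and> b' \<in> A' \<inter> P \<and>
          word_le (SA A') (C * Suc n) b' \<and> word_le (TA A) (cost C n) k"
    if b: "b \<in> A \<inter> P" "word_le (SA A) n b" for n b
  proof -
    obtain z c where zc: "b = z \<otimes> c" "word_le V (Suc n) c"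
      "word_le {v \<otimes> w \<otimes> inv v | v w. w \<in> W \<and> word_le V n v} (Suc n) z"
      using rew[OF b(2,1)] by blast
    have c: "c \<in> A \<inter> A' \<inter> P"
      using zc(2) V(2) subgroups_Inter_pair[OF sub P_subgroup] word_le_subgroup by blast
    \<comment> \<open>The word of conjugates serves to place \<open>z\<close> in \<open>H\<close>;
      its length is estimated by way of \<open>b \<otimes> inv c\<close>.\<close>
    have z: "z \<in> H"
    proof (rule word_le_subgroup[OF zc(3) _ subgroup_axioms])
      have "v \<in> carrier G" if "word_le V n v" for v
        using that V(2) A family_carrier word_le_closed by blast
      then show "{v \<otimes> w \<otimes> inv v | v w. w \<in> W \<and> word_le V n v} \<subseteq> H"
        using W(2) inv_op_closed2 by auto
    qed
    have carr: "c \<in> carrier G" "z \<in> carrier G" "b \<in> carrier G"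
      using c z b A family_carrier subset by auto
    have z_eq: "z = b \<otimes> inv c" using zc(1) carr by (simp add: m_assoc)
    have "z \<in> A" unfolding z_eq using b c family_subgroup[OF A(1)]
      by (auto intro!: subgroup.m_closed subgroup.m_inv_closed)
    have "n + m1 * Suc n \<le> C * Suc n" unfolding C_def by (simp add: algebra_simps)
    moreover have "word_le (SA A) (n + m1 * Suc n) z"
      unfolding z_eq using word_le_trans[OF zc(2) m1 S(1)] b(2)
      by (intro word_le_mult word_le_inv S)
    ultimately have "word_le (SA A) (C * Suc n) z" using word_le_mono by blast
    then have "word_le (TA A) (D (C * Suc n)) z" using D_bound A \<open>z \<in> A\<close> z by blast
    then have "word_le (TA A) (cost C n) z"
      by (rule word_le_mono) (auto simp: cost_def C_def)
    moreover have "m2 * Suc n \<le> C * Suc n" by (rule mult_le_mono1) (simp add: C_def)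
    then have "word_le (SA A') (C * Suc n) c"
      using word_le_mono[OF word_le_trans[OF zc(2) m2 S(2)] _ order_refl] by blast
    moreover have "b \<otimes> \<one> = z \<otimes> \<one> \<otimes> c" using zc(1) carr by simp
    ultimately show ?thesis using c by blast
  qed
  moreover have "finite (TA A)" "TA A \<subseteq> H" using TA_finite[OF A(1)] TA_subset[OF A(1)] by auto
  ultimately show ?thesis unfolding transport_def using one_closed by blast
qed

lemma transport_chain:
  assumes "As \<noteq> []" "set As \<subseteq> \<A>" "\<And>i. Suc i < length As \<Longrightarrow> P \<subseteq> H <#> (As ! i \<inter> As ! Suc i)"
  shows "transport (hd As) (last As) \<one>"
  using assms
proof (induction As rule: list_nonempty_induct)
  case (single A)
  then show ?case by (simp add: transport_one)
next
  case (cons A As)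
  have "transport (hd As) (last As) \<one>"
  proof (rule cons.IH)
    show "P \<subseteq> H <#> (As ! i \<inter> As ! Suc i)" if "Suc i < length As" for i
      using cons.prems(2)[of "Suc i"] that by simp
  qed (use cons.prems in auto)
  moreover have "P \<subseteq> H <#> (A \<inter> hd As)"
    using cons.prems(2)[of 0] cons.hyps by (auto simp: hd_conv_nth)
  then have "transport A (hd As) \<one>" using cons by (intro transport_link) auto
  ultimately have "transport A (last As) (\<one> \<otimes> \<one>)"
    using cons by (intro transport_mult[of A "hd As" "last As"]) auto
  then show ?case using cons.hyps by simp
qed

text \<open>It suffices to treat elements \<open>a\<close> of a member \<open>A'\<close>: chains
  lead from \<open>A\<close> to \<open>A'\<close> and back by transport along \<open>\<one>\<close>,
  and in between \<open>a\<close> acts inside \<open>A'\<close>.\<close>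

lemma transport_all:
  assumes A: "A \<in> \<A>" and "g \<in> carrier G"
  shows "transport A A g"
proof -
  have one: "transport A A' \<one>" if "A \<in> \<A>" "A' \<in> \<A>" for A A'
    using family_linked[OF that] transport_chain by blast
  have member: "transport A A a" if "A' \<in> \<A>" "a \<in> A'" for A' a
  proof -
    have "transport A A (\<one> \<otimes> a \<otimes> \<one>)"
      using transport_mult[of A A' A] transport_mult[of A A' A'] transport_self[OF that]
        one[OF A that(1)] one[OF that(1) A] A that by blast
    moreover have "a \<in> carrier G" using that family_carrier by blast
    ultimately show ?thesis by simp
  qed
  have "g \<in> generate G (\<Union>\<A>)" using assms family_generate by simp
  then show ?thesis
  proof (induction rule: generate.induct)
    case one then show ?case using A by (rule transport_one)
  next
    case (incl h) then show ?case using member by blast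
  next
    case (inv h)
    then obtain A' where "A' \<in> \<A>" "h \<in> A'" by blast
    then show ?case using member[of A' "inv h"] family_subgroup by (simp add: subgroup.m_inv_closed)
  next
    case (eng h1 h2) then show ?case using transport_mult A by blast
  qed
qed

text \<open>Transport along \<open>h\<close> itself, from \<open>A\<close> to \<open>A\<close>,
  gives \<open>b \<otimes> h = k \<otimes> h \<otimes> c\<close>, so the conjugate equals
  \<open>k \<otimes> (h \<otimes> (c \<otimes> inv b))\<close>. The conjugate, \<open>k\<close> and
  \<open>h\<close> lie in \<open>H\<close>, hence so does \<open>c \<otimes> inv b\<close>; it
  belongs to \<open>A \<inter> H\<close>, has linear length, and \<open>D\<close> applies.\<close>

lemma conjugate_bound:
  assumes A: "A \<in> \<A>" and h: "h \<in> H"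
  shows "\<exists>U C. finite U \<and> U \<subseteq> H \<and>
    (\<forall>n b. b \<in> A \<inter> P \<longrightarrow> word_le (SA A) n b \<longrightarrow> word_le U (cost C n) (b \<otimes> h \<otimes> inv b))"
proof -
  have hC: "h \<in> carrier G" using h subset by blast
  obtain U C where U: "finite U" "U \<subseteq> H"
    "\<And>n b. b \<in> A \<inter> P \<Longrightarrow> word_le (SA A) n b \<Longrightarrow>
       \<exists>k b'. b \<otimes> h = k \<otimes> h \<otimes> b' \<and> b' \<in> A \<inter> P \<and>
          word_le (SA A) (C * Suc n) b' \<and> word_le U (cost C n) k"
    using transport_all[OF A hC] unfolding transport_def by blast
  define U' where "U' = insert h (U \<union> TA A)"
  have U': "finite U'" "U' \<subseteq> H" using U TA_finite[OF A] TA_subset[OF A] h by (auto simp: U'_def)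
  have U'C: "U' \<subseteq> carrier G" using U' subset by blast
  have "word_le U' (cost (C + 1) n) (b \<otimes> h \<otimes> inv b)"
    if b: "b \<in> A \<inter> P" "word_le (SA A) n b" for n b
  proof -
    obtain k c where k: "b \<otimes> h = k \<otimes> h \<otimes> c" "c \<in> A \<inter> P" "word_le (SA A) (C * Suc n) c"
      "word_le U (cost C n) k" using U(3)[OF b] by blast
    have kH: "k \<in> H" using k(4) U(2) subgroup_axioms word_le_subgroup by blast
    have carr: "k \<in> carrier G" "c \<in> carrier G" "b \<in> carrier G"
      using kH k(2) b A family_carrier subset by auto
    have eq: "b \<otimes> h \<otimes> inv b = k \<otimes> (h \<otimes> (c \<otimes> inv b))"
      unfolding k(1) using carr hC by (simp add: m_assoc)
    have "c \<otimes> inv b = inv h \<otimes> (inv k \<otimes> (b \<otimes> h \<otimes> inv b))"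
      unfolding eq using carr hC by simp
    also have "\<dots> \<in> H" using h kH inv_op_closed2[OF carr(3) h] by simp
    finally have "c \<otimes> inv b \<in> A \<inter> H"
      using k(2) b family_subgroup[OF A] by (auto intro!: subgroup.m_closed subgroup.m_inv_closed)
    moreover have "word_le (SA A) (n + C * Suc n) (c \<otimes> inv b)"
      using word_le_mult[OF word_le_inv[OF b(2)] k(3)] SA_carrier[OF A] by (simp add: add.commute)
    then have "word_le (SA A) ((C + 1) * Suc n) (c \<otimes> inv b)" by (rule word_le_mono) auto
    ultimately have "word_le (TA A) (D ((C + 1) * Suc n)) (c \<otimes> inv b)" using D_bound[OF A] by blast
    then have 1: "word_le U' (D ((C + 1) * Suc n)) (c \<otimes> inv b)"
      by (rule word_le_mono) (auto simp: U'_def)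
    have 2: "word_le U' (Suc 0) h" using word_le_gen[OF _ U'C] by (simp add: U'_def)
    have 3: "word_le U' (cost C n) k" using k(4) by (rule word_le_mono) (auto simp: U'_def)
    \<comment> \<open>Raising the constant by one frees a summand
      \<open>Suc (D ((C + 1) * Suc n))\<close>, which pays for \<open>h\<close> and
      \<open>c \<otimes> inv b\<close>.\<close>
    have "cost C n \<le> C * Suc (D ((C + 1) * Suc n))"
      unfolding cost_def by (intro mult_le_mono2 Suc_leI le_imp_less_Suc monoD[OF D_mono]) simp
    then have "cost C n + (Suc 0 + D ((C + 1) * Suc n)) \<le> cost (C + 1) n"
      unfolding cost_def[of "C + 1"] by simp
    with word_le_mult[OF word_le_mult[OF 1 2 U'C] 3 U'C] show ?thesis
      unfolding eq by (rule word_le_mono) auto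
  qed
  then show ?thesis using U' by blast
qed

lemma conjugates_bound:
  assumes A: "A \<in> \<A>" and "finite W" "W \<subseteq> H"
  shows "\<exists>U C. finite U \<and> U \<subseteq> H \<and>
    (\<forall>w\<in>W. \<forall>n b. b \<in> A \<inter> P \<longrightarrow> word_le (SA A) n b \<longrightarrow> word_le U (cost C n) (b \<otimes> w \<otimes> inv b))"
proof -
  have "\<forall>w\<in>W. \<exists>U C. finite U \<and> U \<subseteq> H \<and>
    (\<forall>n b. b \<in> A \<inter> P \<longrightarrow> word_le (SA A) n b \<longrightarrow> word_le U (cost C n) (b \<otimes> w \<otimes> inv b))"
    using conjugate_bound[OF A] assms(3) by blast
  then obtain U C where U: "\<And>w. w \<in> W \<Longrightarrow> finite (U w)" "\<And>w. w \<in> W \<Longrightarrow> U w \<subseteq> H"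
    "\<And>w n b. w \<in> W \<Longrightarrow> b \<in> A \<inter> P \<Longrightarrow> word_le (SA A) n b \<Longrightarrow>
       word_le (U w) (cost (C w) n) (b \<otimes> w \<otimes> inv b)"
    by metis
  have "word_le (\<Union>(U ` W)) (cost (sum C W) n) (b \<otimes> w \<otimes> inv b)"
    if "w \<in> W" "b \<in> A \<inter> P" "word_le (SA A) n b" for w n b
    using U(3)[OF that]
  proof (rule word_le_mono)
    show "cost (C w) n \<le> cost (sum C W) n"
      using that assms(2) by (intro cost_mono) (simp_all add: member_le_sum)
  qed (use that in blast)
  moreover have "finite (\<Union>(U ` W))" "\<Union>(U ` W) \<subseteq> H" using U(1,2) assms(2) by blast+
  ultimately show ?thesis by blast
qed

text \<open>One fixed \<open>A\<close> supplies all conjugators. Since \<open>U\<close> does not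
  depend on \<open>n\<close>, the statement yields finite generation of \<open>H\<close> as well as
  the estimate; the factor \<open>Suc n\<close> counts the conjugates.\<close>

theorem normal_subgroup_bound:
  assumes A: "A \<in> \<A>" and S: "finite S" "S \<subseteq> carrier G"
  shows "\<exists>U C. finite U \<and> U \<subseteq> H \<and>
    (\<forall>n x. x \<in> H \<longrightarrow> word_le S n x \<longrightarrow> word_le U (Suc n * cost C n) x)"
proof -
  obtain V W where V: "finite V" "V \<subseteq> A \<inter> P" and W: "finite W" "W \<subseteq> carrier G \<inter> H"
    and rew: "\<And>n a. word_le S n a \<Longrightarrow> a \<in> carrier G \<inter> P \<Longrightarrow>
      \<exists>z c. a = z \<otimes> c \<and> word_le V (Suc n) c \<and>
        word_le {v \<otimes> w \<otimes> inv v | v w. w \<in> W \<and> word_le V n v} (Suc n) z"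
    by (rule rewriting[OF A family_subgroup[OF A] subgroup_self family_carrier[OF A]
          family_cover[OF A] S]) (rule that; assumption)
  obtain U C where U: "finite U" "U \<subseteq> H"
    and conj: "\<And>w n b. w \<in> W \<Longrightarrow> b \<in> A \<inter> P \<Longrightarrow> word_le (SA A) n b \<Longrightarrow>
      word_le U (cost C n) (b \<otimes> w \<otimes> inv b)"
    using conjugates_bound[OF A W(1)] W(2) by (metis le_inf_iff)
  note SC = SA_carrier[OF A]
  obtain m where m: "\<And>v. v \<in> V \<Longrightarrow> word_le (SA A) m v"
    using word_le_uniform[OF V(1) _ SC] V(2) SA_generate[OF A] by blast
  have AP: "subgroup (A \<inter> P) G" using family_subgroup[OF A] P_subgroup by (rule subgroups_Inter_pair)
  define U' where "U' = U \<union> TA A"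
  have U': "finite U'" "U' \<subseteq> H" using U TA_finite[OF A] TA_subset[OF A] by (auto simp: U'_def)
  have U'C: "U' \<subseteq> carrier G" using U' subset by blast
  \<comment> \<open>The first summand comes from conjugators of length at most \<open>m * n\<close>
    over \<open>SA A\<close>, the second from the remaining factor \<open>c\<close> in
    \<open>A \<inter> H\<close>.\<close>
  define C' where "C' = C * Suc m + Suc m"
  have "word_le U' (Suc n * cost C' n) x" if x: "x \<in> H" "word_le S n x" for n x
  proof -
    let ?Z = "{v \<otimes> w \<otimes> inv v | v w. w \<in> W \<and> word_le V n v}"
    obtain z c where zc: "x = z \<otimes> c" "word_le V (Suc n) c" "word_le ?Z (Suc n) z"
      using rew[OF x(2)] x(1) H_P subset by blast
    have Z: "word_le U (cost C (m * n)) y" if "y \<in> ?Z" for y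
      using that conj word_le_trans[OF _ m SC] word_le_subgroup[OF _ V(2) AP] by blast
    have "U \<subseteq> carrier G" using U subset by blast
    with zc(3) Z have z: "word_le U (cost C (m * n) * Suc n) z" by (rule word_le_trans)
    then have zH: "z \<in> H" using U(2) subgroup_axioms word_le_subgroup by blast
    have cA: "c \<in> A" using word_le_subgroup[OF zc(2) V(2) AP] by blast
    have carr: "z \<in> carrier G" "c \<in> carrier G" using zH cA subset family_carrier A by auto
    have "c = inv z \<otimes> x" using zc(1) carr by simp
    then have "c \<in> A \<inter> H" using cA zH x by simp
    then have c: "word_le (TA A) (D (m * Suc n)) c"
      using D_bound[OF A] word_le_trans[OF zc(2) m SC] by blast
    have "D (m * Suc n) \<le> cost (Suc m) n"
      using monoD[OF D_mono, of "m * Suc n" "Suc m * Suc n"] by (simp add: cost_def)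
    also have "\<dots> \<le> cost (Suc m) n * Suc n" by simp
    finally have "cost C (m * n) * Suc n + D (m * Suc n) \<le>
        cost (C * Suc m) n * Suc n + cost (Suc m) n * Suc n"
      using cost_scale[of C m n] by (intro add_mono mult_le_mono1)
    also have "\<dots> \<le> Suc n * cost C' n"
      using cost_add[of "C * Suc m" n "Suc m"] unfolding C'_def
      by (metis add_mult_distrib mult.commute mult_le_mono2)
    finally have total: "cost C (m * n) * Suc n + D (m * Suc n) \<le> Suc n * cost C' n" .
    have "word_le U' (cost C (m * n) * Suc n + D (m * Suc n)) (z \<otimes> c)"
      using z c by (intro word_le_mult[OF _ _ U'C]) (auto simp: U'_def elim: word_le_mono)
    then show ?thesis unfolding zc(1) using total by (rule word_le_mono) auto
  qed
  then show ?thesis using U' by blast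
qed

end

section \<open>Distortion\<close>

text \<open>Pull back a normal subgroup \<open>R\<close> of finite index in the quotient that is
  contained in the images of all \<open>L\<close>. If \<open>p x\<close> lies in \<open>R\<close>,
  it equals \<open>p c\<close> for some \<open>c \<in> L\<close>, which puts \<open>x\<close> in
  \<open>H <#> L\<close>.\<close>

lemma (in normal) exists_finite_index_subgroup:
  assumes "finite \<L>" and L: "\<And>L. L \<in> \<L> \<Longrightarrow> L \<subseteq> carrier G"
    and index: "\<And>L. L \<in> \<L> \<Longrightarrow> finite_index_subgroup ((\<lambda>g. H #> g) ` L) (G Mod H)"
  shows "\<exists>P F. P \<lhd> G \<and> H \<subseteq> P \<and> (\<forall>L\<in>\<L>. P \<subseteq> H <#> L) \<and> finite F \<and> F \<subseteq> carrier G \<and>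
    (\<forall>x\<in>carrier G. \<exists>f\<in>F. x \<otimes> inv f \<in> P)"
proof -
  define Q where "Q = G Mod H"
  define p where "p = (\<lambda>g. H #> g)"
  interpret Q: group Q unfolding Q_def by (rule factorgroup_is_group)
  interpret p: group_hom G Q p
    using r_coset_hom_Mod by (intro group_hom.intro group_hom_axioms.intro is_group Q.is_group) (simp add: p_def Q_def)
  have p_surj: "carrier Q = p ` carrier G" by (auto simp: p_def Q_def FactGroup_def RCOSETS_def)
  have "\<exists>R E. R \<lhd> Q \<and> (\<forall>K\<in>(\<lambda>L. p ` L) ` \<L>. R \<subseteq> K) \<and> finite E \<and> E \<subseteq> carrier Q \<and>
    (\<forall>x\<in>carrier Q. \<exists>e\<in>E. x \<otimes>\<^bsub>Q\<^esub> inv\<^bsub>Q\<^esub> e \<in> R)"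
    using assms(1) index unfolding finite_index_subgroup_def p_def Q_def[symmetric]
    by (intro Q.finite_index_normal_core) auto
  then obtain R E where R: "R \<lhd> Q" "\<And>L. L \<in> \<L> \<Longrightarrow> R \<subseteq> p ` L" and E: "finite E" "E \<subseteq> carrier Q"
    "\<And>x. x \<in> carrier Q \<Longrightarrow> \<exists>e\<in>E. x \<otimes>\<^bsub>Q\<^esub> inv\<^bsub>Q\<^esub> e \<in> R"
    by auto
  interpret R: normal R Q by (rule R)
  define P where "P = {g \<in> carrier G. p g \<in> R}"
  obtain F where F: "finite F" "F \<subseteq> carrier G" "E = p ` F"
    using finite_subset_image[OF E(1)] E(2) p_surj by metis
  have "subgroup P G"
  proof
    show "x \<otimes> y \<in> P" if "x \<in> P" "y \<in> P" for x y
      using that by (simp add: P_def R.m_closed)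
    show "inv x \<in> P" if "x \<in> P" for x
      using that by (simp add: P_def R.m_inv_closed)
  qed (auto simp: P_def)
  moreover have "x \<otimes> h \<otimes> inv x \<in> P" if "x \<in> carrier G" "h \<in> P" for x h
    using that by (simp add: P_def R.inv_op_closed2)
  ultimately have "P \<lhd> G" using normal_inv_iff by blast
  moreover have "H \<subseteq> P"
  proof
    fix h assume h: "h \<in> H"
    then have "p h = \<one>\<^bsub>Q\<^esub>" using rcos_const by (simp add: p_def Q_def FactGroup_def)
    then show "h \<in> P" using h by (simp add: P_def)
  qed
  moreover have "P \<subseteq> H <#> L" if L': "L \<in> \<L>" for L
  proof
    fix x assume x: "x \<in> P"
    then obtain c where c: "c \<in> L" "H #> x = H #> c" using R(2)[OF L'] by (auto simp: P_def p_def)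
    have "x \<in> H #> x" using x by (intro rcos_self subgroup_axioms) (simp add: P_def)
    then show "x \<in> H <#> L" using c unfolding c(2) by (auto simp: r_coset_def set_mult_def)
  qed
  moreover have "\<exists>f\<in>F. x \<otimes> inv f \<in> P" if x: "x \<in> carrier G" for x
  proof -
    obtain f where f: "f \<in> F" "p x \<otimes>\<^bsub>Q\<^esub> inv\<^bsub>Q\<^esub> p f \<in> R" using E(3)[of "p x"] x F(3) by auto
    then show ?thesis using x F(2) by (intro bexI[of _ f]) (auto simp: P_def)
  qed
  ultimately show ?thesis
    using F(1,2) by (intro exI[of _ P] exI[of _ F] conjI ballI)
qed

lemma (in normal) exists_linked_family:
  assumes "finite \<A>" "\<And>A. A \<in> \<A> \<Longrightarrow> subgroup A G" "generate G (\<Union>\<A>) = carrier G"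
    and chain: "\<And>A A'. A \<in> \<A> \<Longrightarrow> A' \<in> \<A> \<Longrightarrow>
      \<exists>As. As \<noteq> [] \<and> set As \<subseteq> \<A> \<and> hd As = A \<and> last As = A' \<and>
        (\<forall>i. Suc i < length As \<longrightarrow>
          finite_index_subgroup ((\<lambda>g. H #> g) ` (As ! i \<inter> As ! Suc i)) (G Mod H))"
    and "\<And>A. A \<in> \<A> \<Longrightarrow> finite (SA A)" "\<And>A. A \<in> \<A> \<Longrightarrow> generate G (SA A) = A"
    and "\<And>A. A \<in> \<A> \<Longrightarrow> finite (TA A)" "\<And>A. A \<in> \<A> \<Longrightarrow> TA A \<subseteq> A \<inter> H"
    and "mono D"
    and "\<And>A n h. A \<in> \<A> \<Longrightarrow> h \<in> A \<inter> H \<Longrightarrow> word_le (SA A) n h \<Longrightarrow> word_le (TA A) (D n) h"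
  shows "\<exists>P F. linked_family H G P F \<A> SA TA D"
proof -
  \<comment> \<open>Only intersections whose image has finite index are kept; all links of the given
    chains are among them, and there are finitely many since \<open>\<A>\<close> is finite.\<close>
  define \<L> where "\<L> = {L \<in> (\<lambda>(A, A'). A \<inter> A') ` (\<A> \<times> \<A>).
    finite_index_subgroup ((\<lambda>g. H #> g) ` L) (G Mod H)}"
  have "finite \<L>" using assms(1) by (simp add: \<L>_def)
  moreover have "L \<subseteq> carrier G" if "L \<in> \<L>" for L
    using that assms(2) subgroup.subset by (fastforce simp: \<L>_def)
  moreover have "finite_index_subgroup ((\<lambda>g. H #> g) ` L) (G Mod H)" if "L \<in> \<L>" for L
    using that by (simp add: \<L>_def)
  ultimately obtain P F where P: "P \<lhd> G" "H \<subseteq> P" "\<And>L. L \<in> \<L> \<Longrightarrow> P \<subseteq> H <#> L"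
    and F: "finite F" "F \<subseteq> carrier G" "\<And>x. x \<in> carrier G \<Longrightarrow> \<exists>f\<in>F. x \<otimes> inv f \<in> P"
    using exists_finite_index_subgroup[of \<L>] by blast
  have linked: "\<exists>As. As \<noteq> [] \<and> set As \<subseteq> \<A> \<and> hd As = A \<and> last As = A' \<and>
        (\<forall>i. Suc i < length As \<longrightarrow> P \<subseteq> H <#> (As ! i \<inter> As ! Suc i))"
    if AA': "A \<in> \<A>" "A' \<in> \<A>" for A A'
  proof -
    obtain As where As: "As \<noteq> []" "set As \<subseteq> \<A>" "hd As = A" "last As = A'"
      "\<And>i. Suc i < length As \<Longrightarrow>
          finite_index_subgroup ((\<lambda>g. H #> g) ` (As ! i \<inter> As ! Suc i)) (G Mod H)"
      using chain[OF AA'] by blast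
    have "P \<subseteq> H <#> (As ! i \<inter> As ! Suc i)" if i: "Suc i < length As" for i
    proof (rule P(3))
      have "As ! i \<in> \<A>" "As ! Suc i \<in> \<A>" using As(2) i by (auto simp: subset_iff)
      then show "As ! i \<inter> As ! Suc i \<in> \<L>" using As(5)[OF i] unfolding \<L>_def by blast
    qed
    then show ?thesis using As(1-4) by blast
  qed
  \<comment> \<open>A chain from \<open>A\<close> to a different member has a first link
    \<open>A \<inter> B\<close>, which already covers \<open>P\<close> modulo \<open>H\<close>. If
    there is no other member, \<open>A\<close> is all of \<open>G\<close>.\<close>
  have cover: "P \<subseteq> H <#> A" if A: "A \<in> \<A>" for A
  proof (cases "\<A> = {A}")
    case True
    then have "carrier G \<subseteq> A" using assms(3) generate_subgroup_incl[OF order_refl assms(2)[OF A]] by simp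
    moreover have "P \<subseteq> carrier G" using P(1) normal_imp_subgroup subgroup.subset by blast
    ultimately have "\<one> \<otimes> x \<in> H <#> A" if "x \<in> P" for x
      using that subgroup.one_closed[OF subgroup_axioms] unfolding set_mult_def by blast
    then show ?thesis using \<open>P \<subseteq> carrier G\<close> by (auto simp: subset_iff)
  next
    case False
    then obtain A' where "A' \<in> \<A>" "A' \<noteq> A" using A by blast
    then obtain As where As: "As \<noteq> []" "hd As = A" "last As = A'"
      "\<And>i. Suc i < length As \<Longrightarrow> P \<subseteq> H <#> (As ! i \<inter> As ! Suc i)"
      using linked[OF A] by blast
    then obtain B Bs where "As = A # B # Bs"
      using \<open>A' \<noteq> A\<close> by (cases As; cases "tl As") auto
    then have "P \<subseteq> H <#> (A \<inter> B)" using As(4)[of 0] by simp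
    also have "H <#> (A \<inter> B) \<subseteq> H <#> A" unfolding set_mult_def by blast
    finally show ?thesis .
  qed
  have "linked_family H G P F \<A> SA TA D"
    by (intro linked_family.intro linked_family_axioms.intro)
      (fact normal_axioms P(1,2) F assms linked cover)+
  then show ?thesis by blast
qed

section \<open>Distortion at natural arguments\<close>

context group begin

definition distortion_nat :: "'a set \<Rightarrow> 'a set \<Rightarrow> 'a set \<Rightarrow> nat \<Rightarrow> nat" where
  "distortion_nat S K T n = Max {word_length G T h | h. h \<in> K \<and> word_length G S h \<le> n}"

text \<open>Word lengths are natural numbers, so only the integer part of \<open>r\<close> matters,
  and lengths in subgroups agree with lengths in \<open>G\<close>.\<close>

lemma distortion_eq:
  assumes "subgroup A G" "S \<subseteq> A" "subgroup K G" "T \<subseteq> K" "0 \<le> r"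
  shows "distortion (G\<lparr>carrier := A\<rparr>) S K T r = of_nat (distortion_nat S K T (nat \<lfloor>r\<rfloor>))"
proof -
  have "real n \<le> r \<longleftrightarrow> n \<le> nat \<lfloor>r\<rfloor>" for n using assms(5) by (simp add: le_nat_iff le_floor_iff)
  then show ?thesis
    using word_length_subgroup[OF assms(1,2)] word_length_subgroup[OF assms(3,4)]
    unfolding distortion_def distortion_nat_def by simp
qed

context
  fixes S K T
  assumes S: "finite S" "S \<subseteq> carrier G" "K \<subseteq> generate G S" and K: "subgroup K G"
    and T: "T \<subseteq> carrier G" "K \<subseteq> generate G T"
begin

lemma distortion_nat_finite: "finite {word_length G T h | h. h \<in> K \<and> word_length G S h \<le> n}"
proof -
  have "{h \<in> K. word_length G S h \<le> n} \<subseteq> {g. word_le S n g}"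
    using word_length_le_iff[OF S(2)] S(3) by blast
  then have "finite {h \<in> K. word_length G S h \<le> n}"
    using finite_word_le[OF S(1)] finite_subset by blast
  then show ?thesis by simp
qed

lemma distortion_nat_bound:
  assumes "h \<in> K" "word_le S n h"
  shows "word_le T (distortion_nat S K T n) h"
proof -
  have "word_length G S h \<le> n" using word_length_le_iff[OF S(2)] S(3) assms by blast
  then have "word_length G T h \<le> distortion_nat S K T n"
    unfolding distortion_nat_def using assms(1) by (intro Max_ge[OF distortion_nat_finite]) blast
  then show ?thesis using word_length_le_iff[OF T(1)] T(2) assms by blast
qed

text \<open>Together with \<open>distortion_nat_bound\<close> this trades the maximum for statements
  about words; \<open>\<one>\<close> lies in every ball, so the maximum is over a nonempty
  set.\<close>

lemma distortion_nat_leI: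
  assumes "\<And>h. h \<in> K \<Longrightarrow> word_le S n h \<Longrightarrow> word_le T m h"
  shows "distortion_nat S K T n \<le> m"
proof -
  have one: "\<one> \<in> K" using K by (rule subgroup.one_closed)
  then have "word_length G S \<one> \<le> n"
    using word_length_le_iff[OF S(2)] S(3) word_le.one by blast
  then have "{word_length G T h | h. h \<in> K \<and> word_length G S h \<le> n} \<noteq> {}" using one by blast
  moreover have "word_length G T h \<le> m" if "h \<in> K" "word_length G S h \<le> n" for h
    using that assms word_length_le_iff[OF S(2)] S(3) word_length_le_iff[OF T(1)] T(2) by blast
  ultimately show ?thesis
    unfolding distortion_nat_def by (subst Max_le_iff[OF distortion_nat_finite]) auto
qed

lemma distortion_nat_mono: "mono (distortion_nat S K T)"
proof
  fix m n :: nat assume "m \<le> n"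
  then show "distortion_nat S K T m \<le> distortion_nat S K T n"
    using distortion_nat_bound word_le_mono by (intro distortion_nat_leI) blast
qed

end

lemma finite_generating_set_subgroup:
  assumes "subgroup A G" "finite_generating_set (G\<lparr>carrier := A\<rparr>) S"
  shows "finite S" "S \<subseteq> A" "generate G S = A"
  using assms generate_consistent[of S A] by (auto simp: finite_generating_set_def)

end

text \<open>Brings the word count to the shape required by domination. In the application
  \<open>m\<close> is the price of a letter of \<open>U\<close> over \<open>T\<close>, and
  \<open>M\<close> is the largest distortion at \<open>(2 * real C + 1) * x\<close>. The added
  \<open>1\<close> keeps the constants positive when \<open>m\<close> or \<open>C\<close> is
  \<open>0\<close>.\<close>

lemma affine_bound_ennreal:
  fixes M :: ennreal and x :: real and m n C d :: nat
  assumes "1 < x" "n = nat \<lfloor>x\<rfloor>" "of_nat d \<le> M"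
  shows "of_nat (m * (Suc n * (C * Suc d))) \<le>
    ennreal (2 * real m * real C + 1) * (ennreal ((2 * real C + 1) * x) * M) +
    ennreal ((2 * real m * real C + 1) * x)"
proof -
  have n: "real n \<le> x" "1 \<le> real n" using assms by (auto simp: le_nat_iff le_floor_iff)
  let ?a = "2 * real m * C + 1"
  \<comment> \<open>For \<open>x > 1\<close> the integer part \<open>n\<close> is at least
    \<open>1\<close>, so one more unit at most doubles \<open>x\<close>.\<close>
  have "real (Suc n) \<le> 2 * x" using n by simp
  then have "real (m * C) * real (Suc n) * real (Suc d) \<le> real (m * C) * (2 * x) * real (Suc d)"
    by (intro mult_right_mono mult_left_mono) auto
  also have "\<dots> \<le> ?a * (x * real (Suc d))" using assms(1) by (simp add: algebra_simps)
  \<comment> \<open>The \<open>Suc\<close> over \<open>d\<close> produces the linear term.\<close>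
  also have "\<dots> = ?a * (1 * x * d) + ?a * x" by (simp add: algebra_simps)
  \<comment> \<open>The dominating function carries its own factor \<open>n\<close>, so rescaling
    its argument also enlarges \<open>x\<close> here.\<close>
  also have "\<dots> \<le> ?a * ((2 * real C + 1) * x * d) + ?a * x"
    using assms(1) by (intro add_right_mono mult_left_mono mult_right_mono) auto
  also have "real (m * C) * real (Suc n) * real (Suc d) = real (m * (Suc n * (C * Suc d)))"
    by (simp only: of_nat_mult ac_simps)
  finally have "real (m * (Suc n * (C * Suc d))) \<le> ?a * ((2 * real C + 1) * x * d) + ?a * x" .
  then have "of_nat (m * (Suc n * (C * Suc d))) \<le> ennreal (?a * ((2 * real C + 1) * x * d) + ?a * x)"
    by (simp only: ennreal_of_nat_eq_real_of_nat ennreal_leI)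
  also have "\<dots> = ennreal ?a * (ennreal ((2 * real C + 1) * x) * of_nat d) + ennreal (?a * x)"
    using assms(1) by (simp add: ennreal_plus ennreal_mult ennreal_of_nat_eq_real_of_nat)
  also have "\<dots> \<le> ennreal ?a * (ennreal ((2 * real C + 1) * x) * M) + ennreal (?a * x)"
    using assms(3) by (intro add_right_mono mult_left_mono) auto
  finally show ?thesis .
qed

section \<open>Finite generation of \<open>H\<close> and domination of its distortion\<close>

theorem theorem1p3:
  fixes G :: "('a, 'b) monoid_scheme" and H :: "'a set" and \<A> :: "'a set set"
    and p :: "'a \<Rightarrow> 'a set"
  defines "p \<equiv> \<lambda>g. H #>\<^bsub>G\<^esub> g"
  assumes "group G"
    and "finitely_generated G"
    and "H \<lhd> G"
    and "finite \<A>"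
    and "\<And>A. A \<in> \<A> \<Longrightarrow> subgroup A G \<and> finitely_generated (G\<lparr>carrier := A\<rparr>)"
    and "generate G (\<Union>\<A>) = carrier G"
    and "\<And>A. A \<in> \<A> \<Longrightarrow> finitely_generated (G\<lparr>carrier := A \<inter> H\<rparr>)"
    and "\<And>A A'. A \<in> \<A> \<Longrightarrow> A' \<in> \<A> \<Longrightarrow>
           \<exists>As. As \<noteq> [] \<and> set As \<subseteq> \<A> \<and> hd As = A \<and> last As = A' \<and>
             (\<forall>i. Suc i < length As \<longrightarrow>
                finite_index_subgroup (p ` (As ! i \<inter> As ! Suc i)) (G Mod H))"
  shows "finitely_generated (G\<lparr>carrier := H\<rparr>) \<and>
    (\<forall>S T SA TA.
       finite_generating_set G S \<longrightarrow>
       finite_generating_set (G\<lparr>carrier := H\<rparr>) T \<longrightarrow>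
       (\<forall>A\<in>\<A>. finite_generating_set (G\<lparr>carrier := A\<rparr>) (SA A) \<and>
               finite_generating_set (G\<lparr>carrier := A \<inter> H\<rparr>) (TA A)) \<longrightarrow>
       distortion G S H T \<preceq>
         (\<lambda>n. ennreal n * (MAX A\<in>\<A>. distortion (G\<lparr>carrier := A\<rparr>) (SA A) (A \<inter> H) (TA A) n)))"
proof -
  interpret normal H G by (rule assms)
  have A_sub: "subgroup A G" if "A \<in> \<A>" for A using assms(6) that by blast
  have AH_sub: "subgroup (A \<inter> H) G" if "A \<in> \<A>" for A
    using A_sub[OF that] subgroup_axioms by (rule subgroups_Inter_pair)
  \<comment> \<open>The inserted \<open>0\<close> keeps the maximum defined for an empty
    family.\<close>
  define D where "D SA TA n = Max (insert 0 ((\<lambda>A. distortion_nat (SA A) (A \<inter> H) (TA A) n) ` \<A>))"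
    for SA TA and n :: nat
  have bound: "\<exists>U C. finite U \<and> U \<subseteq> H \<and>
      (\<forall>n x. x \<in> H \<longrightarrow> word_le S n x \<longrightarrow> word_le U (Suc n * (C * Suc (D SA TA (C * Suc n)))) x)"
    if S: "finite S" "S \<subseteq> carrier G"
      and gen: "\<forall>A\<in>\<A>. finite_generating_set (G\<lparr>carrier := A\<rparr>) (SA A) \<and>
               finite_generating_set (G\<lparr>carrier := A \<inter> H\<rparr>) (TA A)" for S SA TA
  proof (cases "\<A> = {}")
    \<comment> \<open>Without members the group is generated by the empty set and is trivial, so an
      empty alphabet and \<open>C = 0\<close> do.\<close>
    case True
    then have "carrier G = {\<one>\<^bsub>G\<^esub>}" using assms(7) generate_empty by simp
    then have "H = {\<one>\<^bsub>G\<^esub>}" using subset one_closed by auto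
    then show ?thesis using word_le.one by (intro exI[of _ "{}"] exI[of _ 0]) auto
  next
    case False
    then obtain A0 where A0: "A0 \<in> \<A>" by blast
    have SA: "finite (SA A)" "SA A \<subseteq> A" "generate G (SA A) = A" if "A \<in> \<A>" for A
      using finite_generating_set_subgroup[OF A_sub[OF that], of "SA A"] gen that by simp_all
    have TA: "finite (TA A)" "TA A \<subseteq> A \<inter> H" "generate G (TA A) = A \<inter> H" if "A \<in> \<A>" for A
      using finite_generating_set_subgroup[OF AH_sub[OF that], of "TA A"] gen that by simp_all
    have SAC: "SA A \<subseteq> carrier G" "TA A \<subseteq> carrier G" if "A \<in> \<A>" for A
      using SA(2)[OF that] TA(2)[OF that] subgroup.subset[OF A_sub[OF that]] by auto
    have le: "distortion_nat (SA A) (A \<inter> H) (TA A) n \<le> D SA TA n" if "A \<in> \<A>" for A n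
      using that assms(5) unfolding D_def by (simp add: Max_ge)
    have D_mono: "mono (D SA TA)"
    proof
      fix m n :: nat assume "m \<le> n"
      have "distortion_nat (SA A) (A \<inter> H) (TA A) m \<le> D SA TA n" if A: "A \<in> \<A>" for A
      proof -
        have "mono (distortion_nat (SA A) (A \<inter> H) (TA A))"
          using SA[OF A] TA[OF A] SAC[OF A] AH_sub[OF A] by (intro distortion_nat_mono) auto
        then show ?thesis using le[OF A, of n] \<open>m \<le> n\<close> by (meson monoD order_trans)
      qed
      then show "D SA TA m \<le> D SA TA n" using assms(5) unfolding D_def[of _ _ m] by simp
    qed
    have D_bound: "word_le (TA A) (D SA TA n) h" if A: "A \<in> \<A>" "h \<in> A \<inter> H" "word_le (SA A) n h" for A n h
    proof -
      have "word_le (TA A) (distortion_nat (SA A) (A \<inter> H) (TA A) n) h"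
        using SA[OF A(1)] TA[OF A(1)] SAC[OF A(1)] AH_sub[OF A(1)] A(2,3) by (intro distortion_nat_bound) auto
      then show ?thesis using le[OF A(1)] word_le_mono by blast
    qed
    have "\<exists>P F. linked_family H G P F \<A> SA TA (D SA TA)"
      by (rule exists_linked_family)
        (fact assms(5,7) A_sub assms(9)[unfolded p_def] SA TA D_mono D_bound)+
    then obtain P F where "linked_family H G P F \<A> SA TA (D SA TA)" by blast
    then interpret linked_family H G P F \<A> SA TA "D SA TA" .
    show ?thesis using normal_subgroup_bound[OF A0 S] unfolding cost_def .
  qed
  have "finitely_generated (G\<lparr>carrier := H\<rparr>)"
  proof -
    obtain S where S: "finite S" "S \<subseteq> carrier G" "generate G S = carrier G"
      using assms(3) by (auto simp: finitely_generated_def finite_generating_set_def)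
    have "\<forall>A\<in>\<A>. \<exists>X Y. finite_generating_set (G\<lparr>carrier := A\<rparr>) X \<and>
               finite_generating_set (G\<lparr>carrier := A \<inter> H\<rparr>) Y"
      using assms(6,8) by (auto simp: finitely_generated_def)
    then obtain SA TA where gen: "\<forall>A\<in>\<A>. finite_generating_set (G\<lparr>carrier := A\<rparr>) (SA A) \<and>
               finite_generating_set (G\<lparr>carrier := A \<inter> H\<rparr>) (TA A)" by metis
    obtain U C where U: "finite U" "U \<subseteq> H"
      "\<And>n x. x \<in> H \<Longrightarrow> word_le S n x \<Longrightarrow> word_le U (Suc n * (C * Suc (D SA TA (C * Suc n)))) x"
      using bound[OF S(1,2) gen] by blast
    have "x \<in> generate G U" if x: "x \<in> H" for x
    proof -
      have "x \<in> generate G S" using x S(3) by simp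
      then obtain n where "word_le S n x" using generate_imp_word_le S(2) by blast
      then obtain m where "word_le U m x" using U(3)[OF x] by blast
      moreover have "U \<subseteq> carrier G" using U(2) subset by blast
      ultimately show ?thesis by (rule word_le_imp_generate)
    qed
    then have "generate G U = H" using generate_subgroup_incl[OF U(2) subgroup_axioms] by blast
    then have "finite_generating_set (G\<lparr>carrier := H\<rparr>) U"
      using U generate_consistent[OF U(2) subgroup_axioms] by (simp add: finite_generating_set_def)
    then show ?thesis unfolding finitely_generated_def by blast
  qed
  moreover have "distortion G S H T \<preceq>
         (\<lambda>n. ennreal n * (MAX A\<in>\<A>. distortion (G\<lparr>carrier := A\<rparr>) (SA A) (A \<inter> H) (TA A) n))"
    if gS: "finite_generating_set G S" and gT: "finite_generating_set (G\<lparr>carrier := H\<rparr>) T"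
      and gen: "\<forall>A\<in>\<A>. finite_generating_set (G\<lparr>carrier := A\<rparr>) (SA A) \<and>
               finite_generating_set (G\<lparr>carrier := A \<inter> H\<rparr>) (TA A)" for S T SA TA
  proof -
    have S: "finite S" "S \<subseteq> carrier G" "generate G S = carrier G"
      using gS by (auto simp: finite_generating_set_def)
    have T: "finite T" "T \<subseteq> H" "generate G T = H"
      using finite_generating_set_subgroup[OF subgroup_axioms gT] by auto
    have TC: "T \<subseteq> carrier G" using T(2) subset by blast
    obtain U C where U: "finite U" "U \<subseteq> H"
      "\<And>n x. x \<in> H \<Longrightarrow> word_le S n x \<Longrightarrow> word_le U (Suc n * (C * Suc (D SA TA (C * Suc n)))) x"
      using bound[OF S(1,2) gen] by blast
    \<comment> \<open>\<open>T\<close> is arbitrary and may differ from \<open>U\<close>; each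
      letter of \<open>U\<close> becomes a word of length at most \<open>m\<close> over
      \<open>T\<close>.\<close>
    obtain m where m: "\<And>u. u \<in> U \<Longrightarrow> word_le T m u"
      using word_le_uniform[OF U(1) _ TC] U(2) T(3) by blast
    have DH: "distortion G S H T x \<le> of_nat (m * (Suc n * (C * Suc (D SA TA (C * Suc n)))))"
      if x: "0 \<le> x" "n = nat \<lfloor>x\<rfloor>" for x n
    proof -
      have "distortion G S H T x = of_nat (distortion_nat S H T n)"
        using distortion_eq[OF subgroup_self S(2) subgroup_axioms T(2) x(1)] x(2) by simp
      moreover have "distortion_nat S H T n \<le> m * (Suc n * (C * Suc (D SA TA (C * Suc n))))"
        using word_le_trans[OF U(3) m TC] S T TC subset
        by (intro distortion_nat_leI subgroup_axioms) auto
      ultimately show ?thesis by (simp only: of_nat_le_iff)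
    qed
    let ?M = "\<lambda>y. MAX A\<in>\<A>. distortion (G\<lparr>carrier := A\<rparr>) (SA A) (A \<inter> H) (TA A) y"
    have "distortion G S H T x \<le>
        ennreal (2 * real m * real C + 1) *
          (ennreal ((2 * real C + 1) * x) * ?M ((2 * real C + 1) * x)) +
        ennreal ((2 * real m * real C + 1) * x)" if x: "x > 1" for x
    proof -
      define n where "n = nat \<lfloor>x\<rfloor>"
      define y where "y = (2 * real C + 1) * x"
      have n: "real n \<le> x" "1 \<le> real n" using x by (auto simp: n_def le_nat_iff le_floor_iff)
      \<comment> \<open>As \<open>Suc n\<close> is at most \<open>2 * x\<close>, the argument of
        \<open>D\<close> stays below \<open>y\<close>; this is the origin of the scale
        \<open>2 * real C + 1\<close>.\<close>
      have "real (C * Suc n) \<le> real C * (2 * x)"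
        unfolding of_nat_mult using n by (intro mult_left_mono) auto
      also have "\<dots> \<le> y" using x by (simp add: y_def algebra_simps)
      finally have Cn: "C * Suc n \<le> nat \<lfloor>y\<rfloor>" by (rule le_nat_floor)
      have y: "0 \<le> y" using x by (simp add: y_def)
      let ?d = "\<lambda>A. distortion_nat (SA A) (A \<inter> H) (TA A)"
      have "of_nat (?d A (C * Suc n)) \<le> ?M y" if A: "A \<in> \<A>" for A
      proof -
        note SA = finite_generating_set_subgroup[OF A_sub[OF A], of "SA A"]
        note TA = finite_generating_set_subgroup[OF AH_sub[OF A], of "TA A"]
        have SAC: "SA A \<subseteq> carrier G" "TA A \<subseteq> carrier G"
          using SA(2) TA(2) gen A subgroup.subset[OF A_sub[OF A]] by auto
        have "mono (?d A)"
          using SA TA SAC AH_sub[OF A] gen A by (intro distortion_nat_mono) auto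
        then have "?d A (C * Suc n) \<le> ?d A (nat \<lfloor>y\<rfloor>)" using Cn by (rule monoD)
        also have "of_nat (?d A (nat \<lfloor>y\<rfloor>)) =
            distortion (G\<lparr>carrier := A\<rparr>) (SA A) (A \<inter> H) (TA A) y"
          using SA(2) TA(2) gen A
          by (intro distortion_eq[OF A_sub[OF A] _ AH_sub[OF A] _ y, symmetric]) auto
        also have "\<dots> \<le> ?M y" using A assms(5) by (intro Max_ge) auto
        finally show ?thesis by simp
      qed
      \<comment> \<open>The maximum defining \<open>D\<close> is attained, either at
        \<open>0\<close> or at a member of the family, and each of these values is below
        \<open>?M y\<close>.\<close>
      moreover have "D SA TA (C * Suc n) \<in> insert 0 ((\<lambda>A. ?d A (C * Suc n)) ` \<A>)"
        unfolding D_def using assms(5) by (intro Max_in) auto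
      ultimately have "of_nat (D SA TA (C * Suc n)) \<le> ?M y" by auto
      from order_trans[OF DH affine_bound_ennreal[OF x n_def this]] x n_def
      show ?thesis unfolding y_def by simp
    qed
    then show ?thesis
      unfolding dominated_def
      \<comment> \<open>\<open>2 * real m * real C + 1\<close> serves both as the factor and as the
        coefficient of the linear term.\<close>
      by (intro exI[of _ "2 * real m * real C + 1"] exI[of _ "2 * real C + 1"] exI[of _ "1::real"])
        (auto intro: add_nonneg_pos)
  qed
  ultimately show ?thesis by blast
qed

end
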